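(* Let $\alpha\in[0,1]\setminus\mathbb{Q}$ have partial quotients $(\alpha_n)_{n\in\mathbb{N}_0}$, assume that $\sum_n1/\alpha_n<\infty$, and let $\gamma_n>0$ be given by $\gamma_n\alpha_n^{\gamma_n}=1$. Let $X_\alpha$ be the set of irrational $x\in[0,1]$ whose partial quotients satisfy $x_n\geqslant\alpha_n$ for all $n\in\mathbb{N}_0$, and let $\nu_0$ be the probability measure on $X_\alpha$ described in the context. Then for $\nu_0$-a.e. $x\in X_\alpha$ with continued fraction expansion $(x_0,x_1,\ldots)$, $$\limsup_{n\to\infty}\frac{\sum_{k=0}^{n-1}\left(\gamma_k\log(x_k/\alpha_k)-1\right)}{\sqrt{2n\log\log n}}=1.$$ Moreover, with $p_n(x)/q_n(x)$ denoting the $n$-th approximant of $x$, $S$ the continued fraction map, and $\gamma_{-1}:=0$, for $\nu_0$-a.e. $x\in X_\alpha$, $$\limsup_{n\to\infty}\frac{\left(\sum_{k=0}^{n-1}(\gamma_k-\gamma_{k-1})\log\frac{q_{n-k}(S^k(x))}{q_{n-k}(S^k(\alpha))}-1\right)}{\sqrt{2n\log\log n}}=1,$$ where in the numerator the $-1$ is subtracted inside the sum, i.e. the numerator is $\sum_{k=0}^{n-1}\left((\gamma_k-\gamma_{k-1})\log\frac{q_{n-k}(S^k(x))}{q_{n-k}(S^k(\alpha))}-1\right)$.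
   Context: $\mathbb{N}=\{1,2,\ldots\}$, $\mathbb{N}_0=\mathbb{N}\cup\{0\}$. For $x_i\in\mathbb{N}$ write $\llbracket x_0,x_1,\ldots\rrbracket:=\cfrac{1}{x_0+\cfrac{1}{x_1+\cdots}}$; every irrational $x\in[0,1]$ is uniquely $\llbracket x_0,x_1,\ldots\rrbracket$, and $(x_n)$ are its partial quotients. $S(x)=1/x \bmod 1$, so $S^k(\llbracket x_0,x_1,\ldots\rrbracket)=\llbracket x_k,x_{k+1},\ldots\rrbracket$. The $n$-th approximant is the finite continued fraction $p_n(x)/q_n(x)=1/(x_0+1/(x_1+\cdots+1/x_{n-1}))$ in lowest terms, $q_n(x)>0$. Definition of $\nu_0$. Let $\mathcal{W}_n:=\{l\in\mathbb{N}:l\geqslant\alpha_n\}$ and $X_n:=\{(x_n,x_{n+1},\ldots):x_i\in\mathcal{W}_i\ \forall i\geqslant n\}$; a cylinder of length $k$ in $X_n$ is the set of all sequences in $X_n$ with prescribed first $k$ entries, and $X_n$ carries the $\sigma$-algebra generated by cylinders. Put $\delta_n:=(1+\gamma_n)/2$ and $\varphi_n:X_n\to(0,1)$, $\varphi_n(x_n,x_{n+1},\ldots):=\llbracket x_n,x_{n+1},\ldots\rrbracket^{2\delta_n}$. For $x\in X_{n+1}$ and $f:X_n\to\mathbb{R}$ set $\mathbb{L}_n(f)(x):=\sum_{w\in\mathcal{W}_n}\varphi_n(wx)f(wx)$, where $wx\in X_n$ is $x$ with $w$ prepended; $\mathbb{L}_n^k:=\mathbb{L}_{n+k-1}\circ\cdots\circ\mathbb{L}_n$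 ($\mathbb{L}_n^0$ the identity) and $\mathbb{P}_n^k(f):=\mathbb{L}_n^k(f\cdot\mathbb{L}_0^n(\mathbf{1}))/\mathbb{L}_0^{n+k}(\mathbf{1})$, a function on $X_{n+k}$. There is $r\in(0,1)$ such that $\log\varphi_n$ has $r$-Hölder coefficients bounded uniformly in $n$, where the $r$-Hölder coefficient of $f:X_n\to\mathbb{R}$ is $D_r(f):=\sup\{|f(x)-f(y)|/r^k: k\geqslant1,\ x,y \text{ in a common cylinder of length } k\}$. There is a unique sequence of Borel probability measures $\nu_n$ on $X_n$ such that $\int f\,d\nu_n=\lim_{k\to\infty}\mathbb{P}_n^k(f)(x_k)$ for every bounded $f:X_n\to\mathbb{R}$ with $D_r(f)<\infty$ and every sequence $(x_k)$ with $x_k\in X_{n+k}$. The space $X_0$ is identified with $X_\alpha\subset[0,1]$ via $(x_0,x_1,\ldots)\mapsto\llbracket x_0,x_1,\ldots\rrbracket$, and $\nu_0$ is regarded as a probability measure on $X_\alpha$. *)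

theory Defs
  imports "HOL-Probability.Probability"
begin

primrec fin_cf :: "nat \<Rightarrow> (nat \<Rightarrow> nat) \<Rightarrow> 'a::field_char_0" where
  "fin_cf 0 x = 0"
| "fin_cf (Suc n) x = 1 / (of_nat (x 0) + fin_cf n (\<lambda>i. x (Suc i)))"

definition cf :: "(nat \<Rightarrow> nat) \<Rightarrow> real" where
  "cf x = lim (\<lambda>n. fin_cf n x)"

text \<open>Meaningful for irrational points of the unit interval only, where the sequence of
  positive digits exists and is unique.\<close>

definition partial_quotients :: "real \<Rightarrow> nat \<Rightarrow> nat" where
  "partial_quotients x = (THE d. (\<forall>i. 1 \<le> d i) \<and> cf d = x)"

definition cf_map :: "real \<Rightarrow> real" where
  "cf_map x = frac (1 / x)"

text \<open>\<open>quotient_of\<close> returns numerator and denominator in lowest terms, with positive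
  denominator.\<close>

definition approximant_denom :: "nat \<Rightarrow> real \<Rightarrow> int" where
  "approximant_denom n x = snd (quotient_of (fin_cf n (partial_quotients x)))"

definition X_set :: "real \<Rightarrow> real set" where
  "X_set \<alpha> = {x \<in> {0..1} - \<rat>. \<forall>n. partial_quotients \<alpha> n \<le> partial_quotients x n}"

text \<open>In the following \<open>a\<close> is the sequence of partial quotients of \<open>\<alpha>\<close> and \<open>\<gamma>\<close> the sequence
  of exponents. An element \<open>(x\<^sub>n, x\<^sub>n\<^sub>+\<^sub>1, \<dots>)\<close> of \<open>X\<^sub>n\<close> is encoded as
  the function \<open>\<lambda>i. x\<^sub>n\<^sub>+\<^sub>i\<close>, so that prepending \<open>w\<close> to \<open>x\<close> is
  \<open>case_nat w x\<close>.\<close>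

definition X_seq :: "(nat \<Rightarrow> nat) \<Rightarrow> nat \<Rightarrow> (nat \<Rightarrow> nat) set" where
  "X_seq a n = {x. \<forall>i. a (n + i) \<le> x i}"

definition cylinder :: "(nat \<Rightarrow> nat) \<Rightarrow> nat \<Rightarrow> nat \<Rightarrow> (nat \<Rightarrow> nat) \<Rightarrow> (nat \<Rightarrow> nat) set" where
  "cylinder a n k w = {x \<in> X_seq a n. \<forall>i<k. x i = w i}"

definition seq_space :: "(nat \<Rightarrow> nat) \<Rightarrow> nat \<Rightarrow> (nat \<Rightarrow> nat) measure" where
  "seq_space a n = sigma (X_seq a n) {cylinder a n k w | k w. True}"

definition holder_coeff ::
  "(nat \<Rightarrow> nat) \<Rightarrow> real \<Rightarrow> nat \<Rightarrow> ((nat \<Rightarrow> nat) \<Rightarrow> real) \<Rightarrow> ereal" where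
  "holder_coeff a r n f =
     Sup {ereal (\<bar>f x - f y\<bar> / r ^ k) | k w x y.
            1 \<le> k \<and> x \<in> cylinder a n k w \<and> y \<in> cylinder a n k w}"

definition \<delta> :: "(nat \<Rightarrow> real) \<Rightarrow> nat \<Rightarrow> real" where
  "\<delta> \<gamma> n = (1 + \<gamma> n) / 2"

definition \<phi> :: "(nat \<Rightarrow> real) \<Rightarrow> nat \<Rightarrow> (nat \<Rightarrow> nat) \<Rightarrow> real" where
  "\<phi> \<gamma> n x = cf x powr (2 * \<delta> \<gamma> n)"

definition L_op ::
  "(nat \<Rightarrow> nat) \<Rightarrow> (nat \<Rightarrow> real) \<Rightarrow> nat \<Rightarrow> ((nat \<Rightarrow> nat) \<Rightarrow> real) \<Rightarrow> (nat \<Rightarrow> nat) \<Rightarrow> real" where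
  "L_op a \<gamma> n f x = (\<Sum>\<^sub>\<infinity>w\<in>{l. a n \<le> l}. \<phi> \<gamma> n (case_nat w x) * f (case_nat w x))"

primrec L_iter ::
  "(nat \<Rightarrow> nat) \<Rightarrow> (nat \<Rightarrow> real) \<Rightarrow> nat \<Rightarrow> nat \<Rightarrow> ((nat \<Rightarrow> nat) \<Rightarrow> real) \<Rightarrow> (nat \<Rightarrow> nat) \<Rightarrow> real" where
  "L_iter a \<gamma> n 0 f = f"
| "L_iter a \<gamma> n (Suc k) f = L_op a \<gamma> (n + k) (L_iter a \<gamma> n k f)"

definition P_iter ::
  "(nat \<Rightarrow> nat) \<Rightarrow> (nat \<Rightarrow> real) \<Rightarrow> nat \<Rightarrow> nat \<Rightarrow> ((nat \<Rightarrow> nat) \<Rightarrow> real) \<Rightarrow> (nat \<Rightarrow> nat) \<Rightarrow> real" where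
  "P_iter a \<gamma> n k f x =
     L_iter a \<gamma> n k (\<lambda>y. f y * L_iter a \<gamma> 0 n (\<lambda>_. 1) y) x / L_iter a \<gamma> 0 (n + k) (\<lambda>_. 1) x"

definition uniformly_holder :: "(nat \<Rightarrow> nat) \<Rightarrow> (nat \<Rightarrow> real) \<Rightarrow> real \<Rightarrow> bool" where
  "uniformly_holder a \<gamma> r \<longleftrightarrow>
     (\<exists>C::real. \<forall>n. holder_coeff a r n (\<lambda>x. ln (\<phi> \<gamma> n x)) \<le> ereal C)"

definition limit_measures ::
  "(nat \<Rightarrow> nat) \<Rightarrow> (nat \<Rightarrow> real) \<Rightarrow> real \<Rightarrow> (nat \<Rightarrow> (nat \<Rightarrow> nat) measure) \<Rightarrow> bool" where
  "limit_measures a \<gamma> r \<nu> \<longleftrightarrow>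
     (\<forall>n. prob_space (\<nu> n) \<and> sets (\<nu> n) = sets (seq_space a n) \<and>
       (\<forall>f. bounded (f ` X_seq a n) \<and> holder_coeff a r n f < \<infinity> \<longrightarrow>
         (\<forall>x. (\<forall>k. x k \<in> X_seq a (n + k)) \<longrightarrow>
            (\<lambda>k. P_iter a \<gamma> n k f (x k)) \<longlonglongrightarrow> (\<integral>y. f y \<partial>\<nu> n))))"

text \<open>Transport of a measure on \<open>X\<^sub>0\<close> to the corresponding set of irrational numbers.\<close>

definition on_X_set :: "real \<Rightarrow> (nat \<Rightarrow> nat) measure \<Rightarrow> real measure" where
  "on_X_set \<alpha> \<mu> = distr \<mu> (restrict_space borel (X_set \<alpha>)) cf"

end

theory Submission
  imports Defs "HOL-Real_Asymp.Real_Asymp"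
begin

text \<open>Since \<open>cf x = 1 / (x 0 + \<theta>)\<close> with \<open>0 < \<theta> < 1\<close>, the weight \<open>\<phi> \<gamma> n x\<close> differs from \<open>x 0 powr -(1 + \<gamma> n)\<close>
  by a factor at least \<open>exp (- 2 / a n)\<close> and at most 1. As \<open>1 / a n\<close> is summable, the limit measure of a
  cylinder is at most a constant times its measure under the law of independent digits with
  weights \<open>w powr -(1 + \<gamma> i)\<close>, \<open>w \<ge> a i\<close>, so it suffices to treat independent digits. A quantile coupling
  turns the \<open>i\<close>-th digit \<open>w\<close> into a standard exponential variable \<open>e\<close> with
  \<open>\<bar>\<gamma> i * ln (w / a i) - e\<bar> \<le> 2 / a i\<close>, so the first claim is the law of the iterated
  logarithm for exponential variables, for which the maximal inequality for exponential moments
  (upper bound) and the explicit Erlang distribution (lower bound) suffice. For the second claim,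
  \<open>q (n + 1) x = q n (S x) * (x 0 + fin_cf n (S x))\<close> and summation by parts show that the two sums
  differ by at most the sum of all \<open>1 / a k\<close>.\<close>

section \<open>Continued fractions\<close>

text \<open>The exponential law comes from the tails of the weights: the sum of
  \<open>w powr - (1 + \<gamma> i)\<close> over \<open>w \<ge> m\<close> is close to
  \<open>m powr - \<gamma> i / \<gamma> i\<close>. Hence \<open>w / a i\<close> is nearly Pareto
  distributed with index \<open>\<gamma> i\<close>, and \<open>\<gamma> i * ln (w / a i)\<close>
  exceeds t with probability close to \<open>exp (- t)\<close>. This law has mean and variance 1,
  which explains both the subtracted 1 and the value 1 of the limsup. The obstacle is that the
  digits are dependent under the limit measure, which is known only through limits of ratios of
  iterated operators. A one-sided bound on cylinders is enough to overcome it: it makes the limit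
  measure absolutely continuous with respect to the law of independent digits, and almost sure
  statements pass in that direction. The remaining comparisons hold path by path, with errors
  bounded by a multiple of the convergent sum of \<open>1 / a i\<close>; they vanish after division
  by \<open>sqrt (2 * n * ln (ln n))\<close>. The equation defining \<open>\<gamma> i\<close> gives
  \<open>\<gamma> i \<le> 1\<close>, which makes these errors uniform in
  \<open>\<gamma> i\<close>.\<close>

lemma fin_cf_bounds:
  assumes "\<And>i. 1 \<le> d i"
  shows "0 \<le> (fin_cf n d :: real)" "(fin_cf n d :: real) \<le> 1"
proof -
  have "0 \<le> (fin_cf n d :: real) \<and> (fin_cf n d :: real) \<le> 1"
    using assms
  proof (induction n arbitrary: d)
    case (Suc n)
    have "0 \<le> (fin_cf n (\<lambda>i. d (Suc i)) :: real)" by (rule Suc.IH[THEN conjunct1]) (rule Suc.prems)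
    moreover have "1 \<le> real (d 0)" using Suc.prems by simp
    ultimately show ?case by simp
  qed simp
  thus "0 \<le> (fin_cf n d :: real)" "(fin_cf n d :: real) \<le> 1" by auto
qed

text \<open>After clearing denominators the difference is \<open>s - t\<close> over a product of two
  factors, each at least 2. Two steps are taken at once because the single step
  \<open>s \<mapsto> 1 / (a + s)\<close> has slope of modulus 1 at \<open>a = 1\<close>,
  \<open>s = 0\<close>.\<close>

lemma two_step_contraction:
  fixes a b s t :: real
  assumes "1 \<le> a" "1 \<le> b" "0 \<le> s" "0 \<le> t"
  shows "\<bar>1 / (a + 1 / (b + s)) - 1 / (a + 1 / (b + t))\<bar> \<le> \<bar>s - t\<bar> / 4"
proof -
  have p: "2 \<le> a * (b + u) + 1" if "0 \<le> u" for u
  proof -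
    have "1 * 1 \<le> a * (b + u)" using assms that by (intro mult_mono) auto
    thus ?thesis by simp
  qed
  have e: "1 / (a + 1 / (b + u)) = (b + u) / (a * (b + u) + 1)" if "0 \<le> u" for u
  proof -
    have "b + u \<noteq> 0" using assms that by linarith
    hence "a + 1 / (b + u) = (a * (b + u) + 1) / (b + u)" by (simp add: add_divide_distrib)
    thus ?thesis by simp
  qed
  have "1 / (a + 1 / (b + s)) - 1 / (a + 1 / (b + t)) =
      (s - t) / ((a * (b + s) + 1) * (a * (b + t) + 1))"
  proof -
    have "a * (b + s) + 1 \<noteq> 0" "a * (b + t) + 1 \<noteq> 0" using p[OF assms(3)] p[OF assms(4)] by linarith+
    thus ?thesis unfolding e[OF assms(3)] e[OF assms(4)]
      by (subst diff_frac_eq) (simp_all, simp add: algebra_simps)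
  qed
  also have "\<bar>\<dots>\<bar> = \<bar>s - t\<bar> / ((a * (b + s) + 1) * (a * (b + t) + 1))"
    using p[OF assms(3)] p[OF assms(4)] by (simp add: abs_mult)
  also have "\<dots> \<le> \<bar>s - t\<bar> / (2 * 2)"
    using p[OF assms(3)] p[OF assms(4)] by (intro divide_left_mono mult_mono) (auto intro!: mult_pos_pos)
  finally show ?thesis by simp
qed

lemma fin_cf_close:
  assumes "\<And>i. 1 \<le> d i"
  shows "\<bar>fin_cf (2 * k + n) d - fin_cf (2 * k + m) d\<bar> \<le> (1 / 4 :: real) ^ k"
  using assms
proof (induction k arbitrary: d)
  case 0
  show ?case using fin_cf_bounds[of d, OF 0, of n] fin_cf_bounds[of d, OF 0, of m] by simp
next
  case (Suc k)
  let ?e = "\<lambda>i. d (Suc (Suc i))"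
  have "\<bar>fin_cf (2 * Suc k + n) d - fin_cf (2 * Suc k + m) d\<bar>
      \<le> \<bar>fin_cf (2 * k + n) ?e - fin_cf (2 * k + m) ?e :: real\<bar> / 4"
    using two_step_contraction[of "real (d 0)" "real (d (Suc 0))"
        "fin_cf (2 * k + n) ?e" "fin_cf (2 * k + m) ?e"]
      Suc.prems fin_cf_bounds(1)[of ?e] by simp
  also have "\<dots> \<le> (1 / 4) ^ k / 4" using Suc.IH[of ?e] Suc.prems by simp
  finally show ?case by simp
qed

lemma fin_cf_tendsto_cf:
  assumes "\<And>i. 1 \<le> d i"
  shows "(\<lambda>n. fin_cf n d) \<longlonglongrightarrow> cf d"
proof -
  have "Cauchy (\<lambda>n. fin_cf n d :: real)"
  proof (rule metric_CauchyI)
    fix e :: real assume "0 < e"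
    then obtain k where k: "(1 / 4 :: real) ^ k < e" using real_arch_pow_inv[of e "1/4"] by auto
    have "dist (fin_cf m d) (fin_cf n d :: real) < e" if "2 * k \<le> m" "2 * k \<le> n" for m n
    proof -
      have "\<bar>fin_cf m d - fin_cf n d :: real\<bar> \<le> (1 / 4) ^ k"
        using fin_cf_close[of d k "m - 2 * k" "n - 2 * k", OF assms] that by simp
      thus ?thesis using k by (simp add: dist_real_def)
    qed
    thus "\<exists>M. \<forall>m\<ge>M. \<forall>n\<ge>M. dist (fin_cf m d) (fin_cf n d :: real) < e" by blast
  qed
  thus ?thesis unfolding cf_def
    using real_Cauchy_convergent convergent_LIMSEQ_iff by blast
qed

lemma cf_rec:
  assumes "\<And>i. 1 \<le> d i"
  shows "cf d = 1 / (real (d 0) + cf (\<lambda>i. d (Suc i)))"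
proof -
  let ?e = "\<lambda>i. d (Suc i)"
  have 1: "(\<lambda>n. fin_cf n ?e) \<longlonglongrightarrow> cf ?e" using fin_cf_tendsto_cf[of ?e] assms by simp
  have "0 \<le> cf ?e" using fin_cf_bounds(1)[of ?e] assms by (intro LIMSEQ_le_const[OF 1]) auto
  moreover have "1 \<le> real (d 0)" using assms by simp
  ultimately have "(\<lambda>n. fin_cf (Suc n) d) \<longlonglongrightarrow> 1 / (real (d 0) + cf ?e)"
    by (auto intro!: tendsto_intros 1)
  moreover have "(\<lambda>n. fin_cf (Suc n) d) \<longlonglongrightarrow> cf d"
    using fin_cf_tendsto_cf[of d] assms by (intro LIMSEQ_Suc) auto
  ultimately show ?thesis by (rule LIMSEQ_unique[rotated])
qed

lemma cf_bounds:
  assumes "\<And>i. 1 \<le> d i"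
  shows "0 < cf d" "cf d < 1"
proof -
  have pos: "0 < cf e" if "\<And>i. 1 \<le> e i" for e
  proof -
    have 1: "(\<lambda>n. fin_cf n (\<lambda>i. e (Suc i))) \<longlonglongrightarrow> cf (\<lambda>i. e (Suc i))"
      using fin_cf_tendsto_cf[of "\<lambda>i. e (Suc i)"] that by simp
    have "0 \<le> cf (\<lambda>i. e (Suc i))"
      using fin_cf_bounds(1)[of "\<lambda>i. e (Suc i)"] that by (intro LIMSEQ_le_const[OF 1]) auto
    moreover have "1 \<le> real (e 0)" using that by simp
    ultimately have "0 < real (e 0) + cf (\<lambda>i. e (Suc i))" by linarith
    thus ?thesis using cf_rec[of e] that by simp
  qed
  show "0 < cf d" by (rule pos) (rule assms)
  have "1 \<le> real (d 0)" using assms by simp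
  moreover have "0 < cf (\<lambda>i. d (Suc i))" by (rule pos) (rule assms)
  ultimately show "cf d < 1" using cf_rec[of d, OF assms] by simp
qed

text \<open>Infinite descent on the denominator: if \<open>cf e = p / q\<close>, then
  \<open>0 < p < q\<close>, and the shifted sequence has the value \<open>(q - p * e 0) / p\<close>,
  a fraction with the smaller denominator p.\<close>

lemma cf_irrational:
  assumes "\<And>i. 1 \<le> d i"
  shows "cf d \<notin> \<rat>"
proof
  assume "cf d \<in> \<rat>"
  then obtain p q :: nat where q0: "q \<noteq> 0" and pq: "\<bar>cf d\<bar> = p / q" by (rule Rats_abs_nat_div_natE)
  moreover have "real q * cf e \<noteq> real p" if "0 < q" "\<And>i. 1 \<le> e i" for p q :: nat and e
    using that
  proof (induction q arbitrary: p e rule: less_induct)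
    case (less q)
    show ?case
    proof
      assume eq: "real q * cf e = real p"
      let ?t = "\<lambda>i. e (Suc i)"
      have b: "0 < cf e" "cf e < 1" "0 < cf ?t" using cf_bounds less.prems by auto
      have "0 < real p" unfolding eq[symmetric] using b less.prems by simp
      hence p: "0 < p" by simp
      have "real p < real q" unfolding eq[symmetric] using b less.prems by simp
      hence pq: "p < q" by simp
      have "real q = real p * (real (e 0) + cf ?t)"
      proof -
        have "cf e * (real (e 0) + cf ?t) = 1"
        proof -
          have "real (e 0) + cf ?t \<noteq> 0" using b by linarith
          thus ?thesis by (subst cf_rec[of e, OF less.prems(2)]) simp
        qed
        thus ?thesis unfolding eq[symmetric] by (simp add: mult.assoc)
      qed
      hence e: "real p * cf ?t = real q - real (p * e 0)" by (simp add: algebra_simps)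
      moreover have "0 < real p * cf ?t" using b(3) p by simp
      ultimately have "real (p * e 0) < real q" by linarith
      hence "p * e 0 \<le> q" unfolding of_nat_less_iff by (rule less_imp_le)
      hence "real p * cf ?t = real (q - p * e 0)" unfolding e by (rule of_nat_diff[symmetric])
      moreover have "real p * cf ?t \<noteq> real (q - p * e 0)"
        by (rule less.IH[OF pq p]) (rule less.prems(2))
      ultimately show False by (rule notE[rotated])
    qed
  qed
  ultimately have "real q * cf d \<noteq> real p" using q0 assms by (metis neq0_conv)
  hence "real q * \<bar>cf d\<bar> \<noteq> real p" using cf_bounds(1)[of d, OF assms] by (simp only: abs_of_pos simp_thms)
  moreover have "real q * \<bar>cf d\<bar> = real p"
    unfolding pq using q0 by simp
  ultimately show False by (rule notE)
qed

lemma floor_inverse_cf: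
  assumes "\<And>i. 1 \<le> d i"
  shows "nat \<lfloor>1 / cf d\<rfloor> = d 0" "cf_map (cf d) = cf (\<lambda>i. d (Suc i))"
proof -
  let ?t = "\<lambda>i. d (Suc i)"
  have 1: "1 / cf d = real (d 0) + cf ?t" using cf_rec[of d] assms by simp
  have b: "0 < cf ?t" "cf ?t < 1" using cf_bounds[of ?t] assms by auto
  have 2: "\<lfloor>1 / cf d\<rfloor> = int (d 0)" unfolding 1 using b by linarith
  show "nat \<lfloor>1 / cf d\<rfloor> = d 0" by (simp add: 2)
  show "cf_map (cf d) = cf (\<lambda>i. d (Suc i))" unfolding cf_map_def frac_def 2 unfolding 1 by simp
qed

lemma cf_map_funpow_cf:
  assumes "\<And>i. 1 \<le> d i"
  shows "(cf_map ^^ k) (cf d) = cf (\<lambda>i. d (k + i))"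
proof (induction k)
  case (Suc k)
  have "cf_map (cf (\<lambda>i. d (k + i))) = cf (\<lambda>i. d (k + Suc i))"
    by (rule floor_inverse_cf(2)) (rule assms)
  thus ?case by (simp add: Suc.IH)
qed simp

lemma cf_inj:
  assumes "\<And>i. 1 \<le> d i" "\<And>i. 1 \<le> e i" "cf d = cf e"
  shows "d = e"
proof
  fix i
  have digit: "nat \<lfloor>1 / (cf_map ^^ i) (cf f)\<rfloor> = f i" if "\<And>i. 1 \<le> f i" for f
    using floor_inverse_cf(1)[of "\<lambda>j. f (i + j)", OF that] unfolding cf_map_funpow_cf[of f i, OF that] by simp
  show "d i = e i" using digit[of d, OF assms(1)] digit[of e, OF assms(2)] unfolding assms(3) by (rule trans[OF sym])
qed

lemma partial_quotients_cf:
  assumes "\<And>i. 1 \<le> d i"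
  shows "partial_quotients (cf d) = d"
  unfolding partial_quotients_def
proof (rule the_equality)
  show "(\<forall>i. 1 \<le> d i) \<and> cf d = cf d" using assms by blast
  show "e = d" if "(\<forall>i. 1 \<le> e i) \<and> cf e = cf d" for e
    by (rule cf_inj) (use that assms in blast)+
qed

lemma partial_quotients_cf_map:
  assumes "\<And>i. 1 \<le> d i"
  shows "partial_quotients ((cf_map ^^ k) (cf d)) = (\<lambda>i. d (k + i))"
  using partial_quotients_cf[of "\<lambda>i. d (k + i)"] assms by (simp add: cf_map_funpow_cf)

text \<open>Existence of the expansion: the digits are read off by iterating \<open>cf_map\<close>.
  The explicit formula in the third claim is what makes the digits measurable later, as the
  definition by \<open>THE\<close> gives no handle on that.\<close>

lemma cf_expansion:
  assumes "x \<in> {0..1} - \<rat>"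
  shows "\<And>i. 1 \<le> partial_quotients x i" "cf (partial_quotients x) = x"
    "partial_quotients x i = nat \<lfloor>1 / (cf_map ^^ i) x\<rfloor>"
proof -
  have cf_map: "cf_map y \<in> {0..1} - \<rat>" if "y \<in> {0..1} - \<rat>" for y
  proof -
    have "cf_map y = 1 / y - of_int \<lfloor>1 / y\<rfloor>" by (simp add: cf_map_def frac_def)
    moreover have "1 / y \<notin> \<rat>" using that Rats_inverse[of "1 / y"] by auto
    ultimately have "cf_map y \<notin> \<rat>" by (metis Rats_add Rats_of_int diff_add_cancel)
    thus ?thesis by (auto simp: cf_map_def intro: frac_ge_0 frac_lt_1 less_imp_le)
  qed
  have it: "(cf_map ^^ i) y \<in> {0..1} - \<rat>" if "y \<in> {0..1} - \<rat>" for i y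
    using that cf_map by (induction i) auto
  define D where "D y i = nat \<lfloor>1 / (cf_map ^^ i) y\<rfloor>" for y i
  have Dpos: "1 \<le> D y i" if "y \<in> {0..1} - \<rat>" for y i
  proof -
    have "(cf_map ^^ i) y \<noteq> 0" using it[OF that, of i] by (metis DiffD2 Rats_0)
    hence "1 \<le> 1 / (cf_map ^^ i) y" using it[OF that, of i] by auto
    hence "1 \<le> \<lfloor>1 / (cf_map ^^ i) y\<rfloor>" by simp
    thus ?thesis unfolding D_def by linarith
  qed
  have Drec: "y = 1 / (real (D y 0) + cf_map y)" "(\<lambda>i. D y (Suc i)) = D (cf_map y)" if "y \<in> {0..1} - \<rat>" for y
  proof -
    have "real (D y 0) = of_int \<lfloor>1 / y\<rfloor>" using Dpos[OF that, of 0] unfolding D_def by simp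
    thus "y = 1 / (real (D y 0) + cf_map y)" by (simp add: cf_map_def frac_def)
    show "(\<lambda>i. D y (Suc i)) = D (cf_map y)" by (rule ext) (simp only: D_def funpow_Suc_right comp_def)
  qed
  \<comment> \<open>The point y obeys the same two-step recursion as its truncations, with
    \<open>cf_map (cf_map y)\<close> in place of the truncated tail, so the contraction compares the
    two.\<close>
  have close: "\<bar>fin_cf (2 * k) (D y) - y\<bar> \<le> (1 / 4) ^ k" if "y \<in> {0..1} - \<rat>" for k y
    using that
  proof (induction k arbitrary: y)
    case 0
    thus ?case by auto
  next
    case (Suc k)
    let ?z = "cf_map (cf_map y)"
    have z: "cf_map y \<in> {0..1} - \<rat>" "?z \<in> {0..1} - \<rat>" using cf_map Suc.prems by auto
    have "\<bar>fin_cf (2 * Suc k) (D y) - y\<bar>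
      = \<bar>1 / (real (D y 0) + 1 / (real (D (cf_map y) 0) + fin_cf (2 * k) (D ?z)))
         - 1 / (real (D y 0) + 1 / (real (D (cf_map y) 0) + ?z))\<bar>"
      using Drec(1)[OF Suc.prems] Drec(1)[OF z(1)] Drec(2)[OF Suc.prems] Drec(2)[OF z(1)]
      by (simp add: fun_eq_iff)
    also have "\<dots> \<le> \<bar>fin_cf (2 * k) (D ?z) - ?z\<bar> / 4"
      using Dpos[OF Suc.prems, of 0] Dpos[OF z(1), of 0] z(2)
        fin_cf_bounds(1)[of "D ?z", OF Dpos[OF z(2)]]
      by (intro two_step_contraction) auto
    also have "\<dots> \<le> (1 / 4) ^ k / 4" using Suc.IH[OF z(2)] by simp
    finally show ?case by simp
  qed
  have "(\<lambda>k. fin_cf (2 * k) (D x) - x) \<longlonglongrightarrow> 0"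
  proof (rule Lim_null_comparison)
    show "\<forall>\<^sub>F k in sequentially. norm (fin_cf (2 * k) (D x) - x) \<le> (1 / 4) ^ k"
      using close[OF assms] by simp
  qed (simp add: LIMSEQ_realpow_zero)
  hence "(\<lambda>k. fin_cf (2 * k) (D x)) \<longlonglongrightarrow> x" by (simp add: LIM_zero_iff)
  \<comment> \<open>Even lengths suffice to identify the limit, since the whole sequence of
    truncations is already known to converge.\<close>
  moreover have "(\<lambda>k. fin_cf (2 * k) (D x)) \<longlonglongrightarrow> cf (D x)"
    using LIMSEQ_subseq_LIMSEQ[OF fin_cf_tendsto_cf[of "D x", OF Dpos[OF assms]], of "\<lambda>k. 2 * k"]
    by (simp add: strict_mono_def comp_def)
  ultimately have x: "cf (D x) = x" by (rule LIMSEQ_unique[rotated])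
  hence pq: "partial_quotients x = D x"
    using partial_quotients_cf[of "D x", OF Dpos[OF assms]] by simp
  show "\<And>i. 1 \<le> partial_quotients x i" "cf (partial_quotients x) = x"
    "partial_quotients x i = nat \<lfloor>1 / (cf_map ^^ i) x\<rfloor>"
    using pq x Dpos[OF assms] by (auto simp: D_def)
qed

section \<open>Denominators of approximants and summation by parts\<close>

text \<open>\<open>approximant_denom\<close> as a function of the digits instead of the point, so
  that iterating \<open>cf_map\<close> becomes a shift of the index.\<close>

definition cf_denom :: "nat \<Rightarrow> (nat \<Rightarrow> nat) \<Rightarrow> int" where
  "cf_denom n d = snd (quotient_of (fin_cf n d))"

text \<open>\<open>quotient_of\<close> forces \<open>fin_cf\<close> to be evaluated in the
  rationals, while all estimates are made in the reals.\<close>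

lemma of_rat_fin_cf: "of_rat (fin_cf n d) = (fin_cf n d :: real)"
  by (induction n arbitrary: d) (simp_all add: of_rat_divide of_rat_add)

lemma cf_denom_pos: "0 < cf_denom n d"
  unfolding cf_denom_def by (cases "quotient_of (fin_cf n d)") (simp add: quotient_of_denom_pos)

text \<open>If the shifted fraction is \<open>p / q\<close> in lowest terms, the full one is
  \<open>q / (d 0 * q + p)\<close>. This is again in lowest terms, because
  \<open>gcd q (d 0 * q + p) = gcd q p\<close>; so no cancellation disturbs the recursion.\<close>

lemma cf_denom_Suc:
  assumes "\<And>i. 1 \<le> d i"
  shows "real_of_int (cf_denom (Suc n) d) =
    real_of_int (cf_denom n (\<lambda>i. d (Suc i))) * (real (d 0) + fin_cf n (\<lambda>i. d (Suc i)))"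
proof -
  let ?t = "\<lambda>i. d (Suc i)"
  obtain p q where pq: "quotient_of (fin_cf n ?t) = (p, q)" by (cases "quotient_of (fin_cf n ?t)")
  have q: "0 < q" and cop: "coprime p q" and eq: "fin_cf n ?t = (of_int p / of_int q :: rat)"
    using quotient_of_denom_pos[OF pq] quotient_of_coprime[OF pq] quotient_of_div[OF pq] by auto
  have r: "fin_cf n ?t = (of_int p / of_int q :: real)"
    using arg_cong[OF eq, of "of_rat :: _ \<Rightarrow> real"]
    by (simp only: of_rat_fin_cf of_rat_divide of_rat_of_int_eq)
  hence p: "0 \<le> p" using fin_cf_bounds(1)[of ?t n] assms q
    by (simp add: zero_le_divide_iff)
  define s where "s = int (d 0) * q + p"
  have s: "0 < s" using assms[of 0] q p unfolding s_def by (intro add_pos_nonneg mult_pos_pos) auto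
  have "coprime q s" using cop unfolding s_def
    by (metis coprime_commute coprime_iff_gcd_eq_1 gcd_add_mult mult.commute add.commute)
  hence "quotient_of (Fract q s) = (q, s)" using s by (simp add: quotient_of_Fract Rat.normalize_def)
  moreover have "fin_cf (Suc n) d = Fract q s"
    using q s by (simp add: eq Fract_of_int_quotient s_def field_simps)
  ultimately have "cf_denom (Suc n) d = s" by (simp add: cf_denom_def)
  moreover have "cf_denom n ?t = q" by (simp add: cf_denom_def pq)
  ultimately show ?thesis using q by (simp add: r s_def field_simps)
qed

lemma ln_cf_denom:
  assumes "\<And>i. 1 \<le> d i"
  shows "ln (real_of_int (cf_denom n d)) =
    (\<Sum>j<n. ln (real (d j) + fin_cf (n - Suc j) (\<lambda>i. d (Suc j + i))))"
  using assms
proof (induction n arbitrary: d)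
  case 0
  show ?case by (simp add: cf_denom_def)
next
  case (Suc n)
  have "0 < real (d 0) + fin_cf n (\<lambda>i. d (Suc i))"
  proof (rule add_pos_nonneg)
    show "0 < real (d 0)" using Suc.prems[of 0] by simp
    show "0 \<le> (fin_cf n (\<lambda>i. d (Suc i)) :: real)" by (rule fin_cf_bounds(1)) (rule Suc.prems)
  qed
  hence "ln (real_of_int (cf_denom (Suc n) d)) = ln (real_of_int (cf_denom n (\<lambda>i. d (Suc i))))
      + ln (real (d 0) + fin_cf n (\<lambda>i. d (Suc i)))"
    using cf_denom_pos[of n "\<lambda>i. d (Suc i)"] by (simp add: cf_denom_Suc[OF Suc.prems] ln_mult)
  also have "\<dots> = (\<Sum>j<Suc n. ln (real (d j) + fin_cf (Suc n - Suc j) (\<lambda>i. d (Suc j + i))))"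
    using Suc.IH[of "\<lambda>i. d (Suc i)"] Suc.prems by (subst sum.lessThan_Suc_shift) simp
  finally show ?case .
qed

text \<open>In the double sum the coefficient of \<open>u j\<close> is the sum of the increments of
  \<open>\<gamma>\<close> up to j, which telescopes to \<open>\<gamma> j\<close> because of the
  initial value 0.\<close>

lemma sum_telescope_weights:
  fixes \<gamma> :: "nat \<Rightarrow> real" and u :: "nat \<Rightarrow> real"
  shows "(\<Sum>k<n. (\<gamma> k - (if k = 0 then 0 else \<gamma> (k - 1))) * (\<Sum>j=k..<n. u j)) = (\<Sum>j<n. \<gamma> j * u j)"
proof -
  let ?w = "\<lambda>k. \<gamma> k - (if k = 0 then 0 else \<gamma> (k - 1))"
  have w: "(\<Sum>k<Suc j. ?w k) = \<gamma> j" for j by (induction j) auto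
  show ?thesis
  proof (induction n)
    case (Suc n)
    have "(\<Sum>k<Suc n. ?w k * (\<Sum>j=k..<Suc n. u j))
        = (\<Sum>k<Suc n. ?w k * (\<Sum>j=k..<n. u j) + ?w k * u n)"
      by (intro sum.cong) (auto simp: algebra_simps)
    also have "\<dots> = (\<Sum>k<n. ?w k * (\<Sum>j=k..<n. u j)) + (\<Sum>k<Suc n. ?w k) * u n"
      unfolding sum.distrib sum_distrib_right by simp
    finally show ?case using Suc w by simp
  qed simp
qed

text \<open>Summation by parts turns the denominators into the digits, each perturbed by a truncated
  tail in [0,1]. The tail changes the logarithm of a digit by an amount in
  \<open>[0, 1 / a k]\<close>, for d as well as for a, so the two corrections differ by at most
  \<open>1 / a k\<close>.\<close>

lemma denominator_sum_close:
  fixes \<gamma> :: "nat \<Rightarrow> real"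
  assumes d: "\<And>i. 1 \<le> a i" "\<And>i. a i \<le> d i" and g: "\<And>i. 0 \<le> \<gamma> i" "\<And>i. \<gamma> i \<le> 1"
  shows "\<bar>(\<Sum>k<n. (\<gamma> k - (if k = 0 then 0 else \<gamma> (k - 1))) *
            ln (real_of_int (cf_denom (n - k) (\<lambda>i. d (k + i))) / real_of_int (cf_denom (n - k) (\<lambda>i. a (k + i)))) - 1)
     - (\<Sum>k<n. \<gamma> k * ln (real (d k) / real (a k)) - 1)\<bar> \<le> (\<Sum>k<n. 1 / real (a k))"
proof -
  have d1: "1 \<le> d i" for i using d le_trans by blast
  \<comment> \<open>All shifted fractions are cut off at the same position n, which is why the
    length is \<open>n - k\<close>. Therefore \<open>u e j\<close> does not depend on the starting
    index k.\<close>
  define u where "u e j = ln (real (e j) + fin_cf (n - Suc j) (\<lambda>i. e (Suc j + i)))" for e :: "nat \<Rightarrow> nat" and j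
  have L: "ln (real_of_int (cf_denom (n - k) (\<lambda>i. e (k + i)))) = (\<Sum>j=k..<n. u e j)"
    if "\<And>i. 1 \<le> e i" "k < n" for e k
  proof -
    have "ln (real_of_int (cf_denom (n - k) (\<lambda>i. e (k + i)))) = (\<Sum>j<n - k. u e (k + j))"
      using ln_cf_denom[of "\<lambda>i. e (k + i)" "n - k"] that
      by (simp add: u_def ac_simps diff_diff_eq)
    also have "\<dots> = (\<Sum>j=k..<n. u e j)"
      using sum.shift_bounds_nat_ivl[of "u e" 0 k "n - k"] that
      by (simp add: atLeast0LessThan ac_simps)
    finally show ?thesis .
  qed
  have "(\<Sum>k<n. (\<gamma> k - (if k = 0 then 0 else \<gamma> (k - 1))) *
            ln (real_of_int (cf_denom (n - k) (\<lambda>i. d (k + i))) / real_of_int (cf_denom (n - k) (\<lambda>i. a (k + i)))) - 1)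
      = (\<Sum>k<n. (\<gamma> k - (if k = 0 then 0 else \<gamma> (k - 1))) * (\<Sum>j=k..<n. u d j - u a j) - 1)"
    using d(1) d1 by (intro sum.cong refl)
      (simp add: ln_div cf_denom_pos less_imp_neq[OF cf_denom_pos, symmetric] L sum_subtractf)
  also have "\<dots> = (\<Sum>k<n. (\<gamma> k - (if k = 0 then 0 else \<gamma> (k - 1))) * (\<Sum>j=k..<n. u d j - u a j)) - n"
    by (subst sum_subtractf) simp
  also have "\<dots> = (\<Sum>k<n. \<gamma> k * (u d k - u a k)) - n"
    by (subst sum_telescope_weights) simp
  finally have eq: "(\<Sum>k<n. (\<gamma> k - (if k = 0 then 0 else \<gamma> (k - 1))) *
            ln (real_of_int (cf_denom (n - k) (\<lambda>i. d (k + i))) / real_of_int (cf_denom (n - k) (\<lambda>i. a (k + i)))) - 1)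
     - (\<Sum>k<n. \<gamma> k * ln (real (d k) / real (a k)) - 1)
     = (\<Sum>k<n. \<gamma> k * ((u d k - ln (real (d k))) - (u a k - ln (real (a k)))))"
    using d(1) d1 by (simp add: sum_subtractf ln_div algebra_simps
      Suc_le_eq sum.distrib)
  have u: "0 \<le> u e k - ln (real (e k)) \<and> u e k - ln (real (e k)) \<le> 1 / real (a k)"
    if e: "\<And>i. a i \<le> e i" for e k
  proof -
    have e1: "1 \<le> e i" for i using d(1) e le_trans by blast
    define t where "t = (fin_cf (n - Suc k) (\<lambda>i. e (Suc k + i)) :: real)"
    have t: "0 \<le> t" "t \<le> 1"
      using fin_cf_bounds[of "\<lambda>i. e (Suc k + i)" "n - Suc k"] e1 unfolding t_def by auto
    have p: "0 < real (e k)" "0 < real (a k)" using e1[of k] d(1)[of k] by simp_all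
    have "u e k - ln (real (e k)) = ln (1 + t / real (e k))"
    proof -
      have "1 + t / real (e k) = (real (e k) + t) / real (e k)" using p by (simp add: add_divide_distrib)
      thus ?thesis unfolding u_def t_def[symmetric] using p t by (simp add: ln_divide_pos)
    qed
    moreover have "ln (1 + t / real (e k)) \<le> t / real (e k)" using t p by (intro ln_add_one_self_le_self) auto
    moreover have "t / real (e k) \<le> 1 / real (a k)" using t p e[of k] by (intro frac_le) auto
    moreover have "0 \<le> ln (1 + t / real (e k))" using t p by (intro ln_ge_zero) auto
    ultimately show ?thesis by linarith
  qed
  show ?thesis unfolding eq
  proof (rule order_trans[OF sum_abs], rule sum_mono)
    fix k
    have "\<bar>\<gamma> k * ((u d k - ln (real (d k))) - (u a k - ln (real (a k))))\<bar>
      \<le> 1 * \<bar>(u d k - ln (real (d k))) - (u a k - ln (real (a k)))\<bar>"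
      unfolding abs_mult using g[of k] by (intro mult_right_mono) auto
    also have "\<dots> \<le> 1 / real (a k)" using u[of d k] u[of a k] d by auto
    finally show "\<bar>\<gamma> k * ((u d k - ln (real (d k))) - (u a k - ln (real (a k))))\<bar> \<le> 1 / real (a k)" .
  qed
qed

section \<open>Comparing measures on cylinders\<close>

text \<open>The sets that can be approximated form a sigma-algebra. One set B must serve both
  measures at once, since the inequality between them will be applied to B.\<close>

lemma finite_measures_approx_algebra:
  assumes alg: "algebra \<Omega> A" and "finite_measure M" "finite_measure N"
    and sM: "sets M = sigma_sets \<Omega> A" and sN: "sets N = sigma_sets \<Omega> A"
    and X: "X \<in> sigma_sets \<Omega> A" and "0 < e"
  shows "\<exists>B\<in>A. measure M (sym_diff X B) < e \<and> measure N (sym_diff X B) < e"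
  using X \<open>0 < e\<close>
proof (induction arbitrary: e rule: sigma_sets.induct)
  case (Basic X)
  thus ?case by (intro bexI[of _ X]) auto
next
  case Empty
  have "{} \<in> A" using alg by (simp add: algebra_iff_Un)
  thus ?case using Empty by (intro bexI[of _ "{}"]) auto
next
  case (Compl X)
  obtain B where B: "B \<in> A" "measure M (sym_diff X B) < e" "measure N (sym_diff X B) < e"
    using Compl by blast
  have sub: "A \<subseteq> Pow \<Omega>" using alg by (simp add: algebra_iff_Un)
  have "X \<subseteq> \<Omega>" using sigma_sets_into_sp[OF sub Compl.hyps] .
  moreover have "B \<subseteq> \<Omega>" using B(1) sub by auto
  ultimately have "sym_diff (\<Omega> - X) (\<Omega> - B) = sym_diff X B" by auto
  moreover have "\<Omega> - B \<in> A" using alg B(1) by (simp add: algebra_iff_Un)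
  ultimately show ?case using B by (intro bexI[of _ "\<Omega> - B"]) auto
next
  case (Union X)
  interpret M: finite_measure M by fact
  interpret N: finite_measure N by fact
  have XM: "X i \<in> sets M" and XN: "X i \<in> sets N" for i using Union.hyps sM sN by auto
  have AM: "B \<in> sets M" "B \<in> sets N" if "B \<in> A" for B using that sM sN by auto
  let ?U = "\<Union>i. X i"
  \<comment> \<open>Continuity from above: a finite part of the union already misses only a set of
    small measure.\<close>
  have tail: "\<forall>\<^sub>F n in sequentially. measure R (?U - (\<Union>i<n. X i)) < e / 2"
    if "finite_measure R" "sets R = sigma_sets \<Omega> A" for R
  proof -
    interpret R: finite_measure R by fact
    have XR: "X i \<in> sets R" for i using Union.hyps that by auto
    have "(\<lambda>n. measure R (?U - (\<Union>i<n. X i))) \<longlonglongrightarrow> measure R (\<Inter>n. ?U - (\<Union>i<n. X i))"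
      using XR by (intro R.finite_Lim_measure_decseq) (auto simp: decseq_def intro: order.strict_trans2)
    also have "(\<Inter>n. ?U - (\<Union>i<n. X i)) = {}"
    proof (rule equals0I)
      fix x assume x: "x \<in> (\<Inter>n. ?U - (\<Union>i<n. X i))"
      then obtain i where "x \<in> X i" by auto
      moreover have "x \<in> ?U - (\<Union>j<Suc i. X j)" using x by blast
      ultimately show False by blast
    qed
    finally show ?thesis using \<open>0 < e\<close> by (intro order_tendstoD) auto
  qed
  obtain n where n: "measure M (?U - (\<Union>i<n. X i)) < e / 2" "measure N (?U - (\<Union>i<n. X i)) < e / 2"
    using eventually_conj[OF tail[OF assms(2) sM] tail[OF assms(3) sN]]
    by (auto simp: eventually_sequentially)
  \<comment> \<open>The n errors add up to at most \<open>e / 2\<close>; the summand 1 keeps the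
    denominator positive when n is 0.\<close>
  have "\<forall>i. \<exists>B\<in>A. measure M (sym_diff (X i) B) < e / (2 * (real n + 1)) \<and> measure N (sym_diff (X i) B) < e / (2 * (real n + 1))"
    using Union.IH Union.prems by simp
  then obtain B where B: "\<And>i. B i \<in> A" "\<And>i. measure M (sym_diff (X i) (B i)) < e / (2 * (real n + 1))"
    "\<And>i. measure N (sym_diff (X i) (B i)) < e / (2 * (real n + 1))" by metis
  let ?B = "\<Union>i<n. B i"
  have "?B \<in> A" using B(1) algebra.axioms(1)[OF alg] by (intro ring_of_sets.finite_UN) auto
  moreover have "measure R (sym_diff ?U ?B) < e"
    if R: "finite_measure R" "sets R = sigma_sets \<Omega> A" and t: "measure R (?U - (\<Union>i<n. X i)) < e / 2"
      and b: "\<And>i. measure R (sym_diff (X i) (B i)) < e / (2 * (real n + 1))" for R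
  proof -
    interpret R: finite_measure R by fact
    have XR [measurable]: "X i \<in> sets R" "B i \<in> sets R" for i using Union.hyps R B(1) by auto
    have "measure R (sym_diff ?U ?B) \<le> measure R ((?U - (\<Union>i<n. X i)) \<union> (\<Union>i<n. sym_diff (X i) (B i)))"
      by (rule R.finite_measure_mono) (blast, measurable)
    also have "\<dots> \<le> measure R (?U - (\<Union>i<n. X i)) + measure R (\<Union>i<n. sym_diff (X i) (B i))"
      by (rule measure_Un_le) measurable
    also have "measure R (\<Union>i<n. sym_diff (X i) (B i)) \<le> (\<Sum>i<n. measure R (sym_diff (X i) (B i)))"
      by (rule R.finite_measure_subadditive_finite) auto
    also have "\<dots> \<le> (\<Sum>i<n. e / (2 * (real n + 1)))" using b by (intro sum_mono less_imp_le)
    also have "\<dots> \<le> e / 2" using Union.prems by (simp add: field_simps)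
    finally show ?thesis using t by linarith
  qed
  ultimately show ?case using n B(2,3) assms(2,3) sM sN by (intro bexI[of _ ?B]) auto
qed

text \<open>Replacing X by a set B of the algebra costs e on the left and \<open>C * e\<close> on
  the right, whence \<open>e = \<epsilon> / (C + 1)\<close>.\<close>

lemma measure_le_from_algebra:
  assumes alg: "algebra \<Omega> A" and M: "finite_measure M" and N: "finite_measure N"
    and sM: "sets M = sigma_sets \<Omega> A" and sN: "sets N = sigma_sets \<Omega> A" and "0 \<le> C"
    and le: "\<And>B. B \<in> A \<Longrightarrow> measure N B \<le> C * measure M B" and X: "X \<in> sets M"
  shows "measure N X \<le> C * measure M X"
proof (rule field_le_epsilon)
  fix \<epsilon> :: real assume "0 < \<epsilon>"
  interpret M: finite_measure M by fact
  interpret N: finite_measure N by fact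
  define e where "e = \<epsilon> / (C + 1)"
  have e: "0 < e" using \<open>0 < \<epsilon>\<close> \<open>0 \<le> C\<close> by (simp add: e_def)
  obtain B where B: "B \<in> A" "measure M (sym_diff X B) < e" "measure N (sym_diff X B) < e"
    using finite_measures_approx_algebra[OF alg M N sM sN _ e, of X] X sM by blast
  have s: "X \<in> sets M" "X \<in> sets N" "B \<in> sets M" "B \<in> sets N" using X B(1) sM sN by auto
  have "measure N X \<le> measure N (B \<union> sym_diff X B)" using s by (intro N.finite_measure_mono) auto
  also have "\<dots> \<le> measure N B + measure N (sym_diff X B)" using s by (intro measure_Un_le) auto
  also have "\<dots> \<le> C * measure M B + e" using le[OF B(1)] B(3) by simp
  also have "measure M B \<le> measure M (X \<union> sym_diff X B)" using s by (intro M.finite_measure_mono) auto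
  also have "\<dots> \<le> measure M X + measure M (sym_diff X B)" using s by (intro measure_Un_le) auto
  also have "\<dots> \<le> measure M X + e" using B(2) by simp
  finally have "measure N X \<le> C * (measure M X + e) + e" using \<open>0 \<le> C\<close> by (simp add: mult_left_mono)
  also have "\<dots> = C * measure M X + e * (C + 1)" by (simp add: algebra_simps)
  also have "e * (C + 1) = \<epsilon>" using \<open>0 \<le> C\<close> by (simp add: e_def)
  finally show "measure N X \<le> C * measure M X + \<epsilon>" .
qed

section \<open>Cylinders and sets determined by finitely many coordinates\<close>

lemma cylinder_subset: "cylinder a n k w \<subseteq> X_seq a n"
  by (auto simp: cylinder_def)

lemma space_seq_space: "space (seq_space a n) = X_seq a n"
  unfolding seq_space_def by (rule space_measure_of) (use cylinder_subset in fastforce)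

lemma sets_seq_space: "sets (seq_space a n) = sigma_sets (X_seq a n) {cylinder a n k w | k w. True}"
  unfolding seq_space_def by (rule sets_measure_of) (use cylinder_subset in fastforce)

lemma cylinder_sets: "cylinder a n k w \<in> sets (seq_space a n)"
  unfolding sets_seq_space by blast

text \<open>The sets determined by finitely many coordinates. Unlike the cylinders they form an
  algebra, and B may be infinite.\<close>

definition prefix_sets :: "(nat \<Rightarrow> nat) \<Rightarrow> nat \<Rightarrow> (nat \<Rightarrow> nat) set set" where
  "prefix_sets a n = {{x \<in> X_seq a n. map x [0..<k] \<in> B} | k B. True}"

lemma algebra_prefix_sets: "algebra (X_seq a n) (prefix_sets a n)"
  unfolding algebra_iff_Un
proof (intro conjI ballI)
  show "prefix_sets a n \<subseteq> Pow (X_seq a n)" by (auto simp: prefix_sets_def)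
  show "{} \<in> prefix_sets a n" unfolding prefix_sets_def by (rule CollectI) (rule exI[of _ 0], rule exI[of _ "{}"], simp)
next
  fix E assume "E \<in> prefix_sets a n"
  then obtain k B where "E = {x \<in> X_seq a n. map x [0..<k] \<in> B}" by (auto simp: prefix_sets_def)
  hence "X_seq a n - E = {x \<in> X_seq a n. map x [0..<k] \<in> - B}" by auto
  thus "X_seq a n - E \<in> prefix_sets a n" unfolding prefix_sets_def by blast
next
  fix E F assume "E \<in> prefix_sets a n" "F \<in> prefix_sets a n"
  then obtain k B l D where E: "E = {x \<in> X_seq a n. map x [0..<k] \<in> B}" and F: "F = {x \<in> X_seq a n. map x [0..<l] \<in> D}"
    by (auto simp: prefix_sets_def)
  have t: "take k (map x [0..<k + l]) = map x [0..<k]" "take l (map x [0..<k + l]) = map x [0..<l]" for x :: "nat \<Rightarrow> nat"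
    by (simp_all add: take_map take_upt)
  have "E \<union> F = {x \<in> X_seq a n. map x [0..<k + l] \<in> {u. take k u \<in> B \<or> take l u \<in> D}}"
    unfolding E F mem_Collect_eq t by auto
  thus "E \<union> F \<in> prefix_sets a n" unfolding prefix_sets_def by blast
qed

lemma prefix_set_eq_UN_cylinder:
  "{x \<in> X_seq a n. map x [0..<k] \<in> B} = (\<Union>u\<in>{u \<in> B. length u = k}. cylinder a n k (nth u))"
proof (intro set_eqI iffI)
  fix x assume "x \<in> {x \<in> X_seq a n. map x [0..<k] \<in> B}"
  thus "x \<in> (\<Union>u\<in>{u \<in> B. length u = k}. cylinder a n k (nth u))"
    by (intro UN_I[of "map x [0..<k]"]) (auto simp: cylinder_def)
next
  fix x assume "x \<in> (\<Union>u\<in>{u \<in> B. length u = k}. cylinder a n k (nth u))"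
  then obtain u where u: "u \<in> B" "length u = k" "x \<in> X_seq a n" "\<forall>i<k. x i = u ! i"
    by (auto simp: cylinder_def)
  have "map x [0..<k] = u" using u by (intro nth_equalityI) auto
  thus "x \<in> {x \<in> X_seq a n. map x [0..<k] \<in> B}" using u by auto
qed

text \<open>There are only countably many finite words, so each prefix set is a countable union of
  cylinders.\<close>

lemma sigma_prefix_sets: "sigma_sets (X_seq a n) (prefix_sets a n) = sets (seq_space a n)"
  unfolding sets_seq_space
proof (rule sigma_sets_eqI)
  fix E assume "E \<in> prefix_sets a n"
  then obtain k B where "E = {x \<in> X_seq a n. map x [0..<k] \<in> B}" by (auto simp: prefix_sets_def)
  thus "E \<in> sigma_sets (X_seq a n) {cylinder a n k w |k w. True}"
    unfolding prefix_set_eq_UN_cylinder sets_seq_space[symmetric]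
    by (auto intro!: sets.countable_UN' cylinder_sets)
next
  fix E assume "E \<in> {cylinder a n k w |k w. True}"
  then obtain k w where E: "E = cylinder a n k w" by auto
  have "map x [0..<k] = map w [0..<k] \<longleftrightarrow> (\<forall>i<k. x i = w i)" for x by (auto simp: list_eq_iff_nth_eq)
  hence "E = {x \<in> X_seq a n. map x [0..<k] \<in> {map w [0..<k]}}"
    unfolding E cylinder_def by auto
  hence "E \<in> prefix_sets a n" unfolding prefix_sets_def by blast
  thus "E \<in> sigma_sets (X_seq a n) (prefix_sets a n)" by blast
qed

text \<open>A prefix set is a countable disjoint union of cylinders, so the bound extends to the
  algebra by additivity and from there to all measurable sets. Null sets of M are then null sets of
  N.\<close>

lemma AE_from_cylinder_bound:
  assumes "finite_measure M" "finite_measure N"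
    and sM: "sets M = sets (seq_space a n)" and sN: "sets N = sets (seq_space a n)" and C: "0 \<le> C"
    and le: "\<And>k w. measure N (cylinder a n k w) \<le> C * measure M (cylinder a n k w)"
    and P: "AE x in M. P x"
  shows "AE x in N. P x"
proof -
  interpret M: finite_measure M by fact
  interpret N: finite_measure N by fact
  have "measure N B \<le> C * measure M B" if B: "B \<in> prefix_sets a n" for B
  proof -
    obtain k D where B: "B = (\<Union>u\<in>{u \<in> D. length u = k}. cylinder a n k (nth u))"
      using B unfolding prefix_sets_def prefix_set_eq_UN_cylinder by auto
    have disj: "disjoint_family_on (\<lambda>u. cylinder a n k (nth u)) {u \<in> D. length u = k}"
      unfolding disjoint_family_on_def cylinder_def by (auto simp: list_eq_iff_nth_eq)
    have "emeasure N B = (\<integral>\<^sup>+u. emeasure N (cylinder a n k (nth u)) \<partial>count_space {u \<in> D. length u = k})"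
      unfolding B using disj by (intro emeasure_UN_countable) (auto simp: sN cylinder_sets)
    also have "\<dots> \<le> (\<integral>\<^sup>+u. ennreal C * emeasure M (cylinder a n k (nth u)) \<partial>count_space {u \<in> D. length u = k})"
      using le C by (intro nn_integral_mono)
        (simp add: M.emeasure_eq_measure N.emeasure_eq_measure ennreal_mult[symmetric])
    also have "\<dots> = ennreal C * (\<integral>\<^sup>+u. emeasure M (cylinder a n k (nth u)) \<partial>count_space {u \<in> D. length u = k})"
      by (rule nn_integral_cmult) simp
    also have "(\<integral>\<^sup>+u. emeasure M (cylinder a n k (nth u)) \<partial>count_space {u \<in> D. length u = k}) = emeasure M B"
      unfolding B using disj by (intro emeasure_UN_countable[symmetric]) (auto simp: sM cylinder_sets)
    finally show ?thesis using C
      by (simp add: M.emeasure_eq_measure N.emeasure_eq_measure ennreal_mult[symmetric])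
  qed
  note le_prefix = this
  have bound: "measure N X \<le> C * measure M X" if "X \<in> sets M" for X
    by (rule measure_le_from_algebra[OF algebra_prefix_sets assms(1,2) _ _ C le_prefix that])
      (simp_all only: sigma_prefix_sets sM sN)
  obtain Z where Z: "{x \<in> space M. \<not> P x} \<subseteq> Z" "emeasure M Z = 0" "Z \<in> sets M"
    using P by (rule AE_E)
  have "measure N Z \<le> 0" using bound[OF Z(3)] Z(2) by (simp add: M.emeasure_eq_measure)
  hence "Z \<in> null_sets N" using Z(3) by (simp add: null_sets_def sM sN N.emeasure_eq_measure measure_le_0_iff)
  moreover have "space N = space M" using sM sN by (simp cong: sets_eq_imp_space_eq)
  ultimately show ?thesis using Z(1) by (intro AE_I'[of Z]) auto
qed

section \<open>The law of the iterated logarithm for exponential variables: upper bound\<close>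

text \<open>The maximal inequality for the nonnegative supermartingale
  \<open>exp (\<Sum>i<j. g (\<omega> i))\<close>. The induction conditions on the first variable s:
  the remaining sequence has the same law and must reach the level \<open>a - g s\<close> within n
  steps. For \<open>a \<le> 0\<close> the bound is at least 1.\<close>

lemma (in sequence_space) exponential_maximal_inequality:
  fixes g :: "'a \<Rightarrow> real"
  assumes [measurable]: "g \<in> borel_measurable M"
    and int: "(\<integral>\<^sup>+x. ennreal (exp (g x)) \<partial>M) \<le> 1"
  shows "emeasure S {\<omega> \<in> space S. \<exists>j\<le>n. a \<le> (\<Sum>i<j. g (\<omega> i))} \<le> ennreal (exp (- a))"
proof (induction n arbitrary: a)
  case 0
  show ?case
  proof (cases "a \<le> 0")
    case True
    have "emeasure S {\<omega> \<in> space S. \<exists>j\<le>0. a \<le> (\<Sum>i<j. g (\<omega> i))} \<le> ennreal 1"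
      using P.emeasure_le_1 by simp
    also have "\<dots> \<le> ennreal (exp (- a))" using True by (intro ennreal_leI) simp
    finally show ?thesis .
  qed simp
next
  case (Suc n)
  show ?case
  proof (cases "a \<le> 0")
    case True
    have "emeasure S {\<omega> \<in> space S. \<exists>j\<le>Suc n. a \<le> (\<Sum>i<j. g (\<omega> i))} \<le> ennreal 1"
      using P.emeasure_le_1 by simp
    also have "\<dots> \<le> ennreal (exp (- a))" using True by (intro ennreal_leI) simp
    finally show ?thesis .
  next
    case False
    let ?A = "\<lambda>n a. {\<omega> \<in> space S. \<exists>j\<le>n. a \<le> (\<Sum>i<j. g (\<omega> i))}"
    let ?B = "(\<lambda>(s, \<omega>). case_nat s \<omega>) -` ?A (Suc n) a \<inter> space (M \<Otimes>\<^sub>M S)"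
    have [measurable]: "?A n a \<in> sets S" for n a by measurable
    have B: "?B \<in> sets (M \<Otimes>\<^sub>M S)" by (rule measurable_sets[of _ _ S]) measurable
    have sect: "Pair s -` ?B = ?A n (a - g s)" if s: "s \<in> space M" for s
    proof (intro set_eqI iffI)
      fix \<omega> assume "\<omega> \<in> Pair s -` ?B"
      then obtain j where j: "\<omega> \<in> space S" "j \<le> Suc n" "a \<le> (\<Sum>i<j. g (case_nat s \<omega> i))"
        using s by (auto simp: space_pair_measure split: if_splits)
      \<comment> \<open>The empty sum cannot reach the positive level a, so at least one variable
        has been used.\<close>
      with False obtain j' where j': "j = Suc j'" by (cases j) auto
      have "a - g s \<le> (\<Sum>i<j'. g (\<omega> i))" using j(3) unfolding j' sum.lessThan_Suc_shift by simp
      thus "\<omega> \<in> ?A n (a - g s)" using j j' by auto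
    next
      fix \<omega> assume "\<omega> \<in> ?A n (a - g s)"
      then obtain j where j: "\<omega> \<in> space S" "j \<le> n" "a - g s \<le> (\<Sum>i<j. g (\<omega> i))" by auto
      hence "a \<le> (\<Sum>i<Suc j. g (case_nat s \<omega> i))" unfolding sum.lessThan_Suc_shift by simp
      moreover have "case_nat s \<omega> \<in> space S" using j(1) s
        by (auto simp: space_PiM PiE_iff split: nat.split)
      moreover have "Suc j \<le> Suc n" using j by simp
      ultimately show "\<omega> \<in> Pair s -` ?B" using j(1) s by (auto simp: space_pair_measure)
    qed
    have "emeasure S (?A (Suc n) a) = emeasure (distr (M \<Otimes>\<^sub>M S) S (\<lambda>(s, \<omega>). case_nat s \<omega>)) (?A (Suc n) a)"
      by (simp only: PiM_iter)
    also have "\<dots> = emeasure (M \<Otimes>\<^sub>M S) ?B"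
      by (rule emeasure_distr) measurable
    also have "\<dots> = (\<integral>\<^sup>+s. emeasure S (Pair s -` ?B) \<partial>M)"
      using B by (rule P.emeasure_pair_measure_alt)
    also have "\<dots> = (\<integral>\<^sup>+s. emeasure S (?A n (a - g s)) \<partial>M)"
      by (intro nn_integral_cong arg_cong[where f = "emeasure S"] sect)
    also have "\<dots> \<le> (\<integral>\<^sup>+s. ennreal (exp (- a)) * ennreal (exp (g s)) \<partial>M)"
    proof (rule nn_integral_mono)
      fix s
      have "emeasure S (?A n (a - g s)) \<le> ennreal (exp (- (a - g s)))" by (rule Suc.IH)
      also have "\<dots> = ennreal (exp (- a)) * ennreal (exp (g s))"
        by (simp add: ennreal_mult[symmetric] exp_add[symmetric])
      finally show "emeasure S (?A n (a - g s)) \<le> ennreal (exp (- a)) * ennreal (exp (g s))" .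
    qed
    also have "\<dots> = ennreal (exp (- a)) * (\<integral>\<^sup>+s. ennreal (exp (g s)) \<partial>M)"
      by (rule nn_integral_cmult) measurable
    also have "\<dots> \<le> ennreal (exp (- a)) * 1" using int by (intro mult_left_mono) auto
    finally show ?thesis by simp
  qed
qed

section \<open>Exponential moments and the upper half of the law\<close>

abbreviation std_exp :: "real measure" where
  "std_exp \<equiv> density lborel (\<lambda>x. ennreal (exponential_density 1 x))"

text \<open>Exponential tilting: the integrand is a constant times the exponential density with
  parameter \<open>1 - u\<close>, and that constant is the value of the integral.\<close>

lemma exponential_mgf:
  fixes u :: real
  assumes "u < 1"
  shows "(\<integral>\<^sup>+x. ennreal (exp (u * (x - 1))) \<partial>std_exp) = ennreal (exp (- u - ln (1 - u)))"
proof -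
  have p: "ennreal (exponential_density 1 x) * ennreal (exp (u * (x - 1)))
      = ennreal (exp (- u) / (1 - u)) * ennreal (exponential_density (1 - u) x)" for x
  proof -
    have "exponential_density 1 x * exp (u * (x - 1)) = exp (- u) / (1 - u) * exponential_density (1 - u) x"
    proof (cases "x < 0")
      case False
      have "exp (- x) * exp (u * (x - 1)) = exp (- u) * exp (- x * (1 - u))"
        unfolding exp_add[symmetric] by (simp add: algebra_simps)
      thus ?thesis using assms False by (simp add: exponential_density_def)
    qed (simp add: exponential_density_def)
    thus ?thesis using assms by (simp add: ennreal_mult[symmetric] exponential_density_nonneg)
  qed
  have "(\<integral>\<^sup>+x. ennreal (exp (u * (x - 1))) \<partial>std_exp)
      = (\<integral>\<^sup>+x. ennreal (exponential_density 1 x) * ennreal (exp (u * (x - 1))) \<partial>lborel)"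
    by (rule nn_integral_density) auto
  also have "\<dots> = ennreal (exp (- u) / (1 - u)) * (\<integral>\<^sup>+x. ennreal (exponential_density (1 - u) x) \<partial>lborel)"
    unfolding p by (rule nn_integral_cmult) auto
  also have "(\<integral>\<^sup>+x. ennreal (exponential_density (1 - u) x) \<partial>lborel) = 1"
    using prob_space.emeasure_space_1[OF prob_space_exponential_density[of "1 - u"]] assms
    by (simp add: emeasure_density)
  also have "exp (- u) / (1 - u) = exp (- u - ln (1 - u))" using assms by (simp add: exp_diff)
  finally show ?thesis by simp
qed

text \<open>The logarithmic moment generating function is \<open>u\<^sup>2 / 2\<close> up to third
  order, so near 0 any slack \<open>\<eta>\<close> absorbs the remainder. Both signs of u are
  covered, hence both tails.\<close>

lemma exponential_subgaussian_near_0: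
  fixes \<eta> :: real
  assumes "0 < \<eta>"
  obtains l0 where "0 < l0" "\<And>u. \<bar>u\<bar> < l0 \<Longrightarrow>
    (\<integral>\<^sup>+x. ennreal (exp (u * (x - 1) - (1 + \<eta>) * u\<^sup>2 / 2)) \<partial>std_exp) \<le> 1"
proof -
  have "((\<lambda>u::real. (- u - ln (1 - u)) / u\<^sup>2) \<longlongrightarrow> 1 / 2) (at 0)" by real_asymp
  moreover have "1 / 2 < (1 + \<eta>) / 2" using assms by simp
  ultimately have "\<forall>\<^sub>F u in at 0. (- u - ln (1 - u)) / u\<^sup>2 < (1 + \<eta>) / (2::real)"
    by (rule order_tendstoD)
  then obtain d where d: "0 < d" "\<And>u. u \<noteq> 0 \<Longrightarrow> \<bar>u\<bar> < d \<Longrightarrow> (- u - ln (1 - u)) / u\<^sup>2 < (1 + \<eta>) / (2::real)"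
    unfolding eventually_at by (auto simp: dist_real_def)
  show ?thesis
  proof (rule that[of "min d 1"])
    fix u :: real assume u: "\<bar>u\<bar> < min d 1"
    have le: "- u - ln (1 - u) \<le> (1 + \<eta>) * u\<^sup>2 / 2"
      using d(2)[of u] u by (cases "u = 0") (auto simp: field_simps)
    have "(\<integral>\<^sup>+x. ennreal (exp (u * (x - 1) - (1 + \<eta>) * u\<^sup>2 / 2)) \<partial>std_exp)
        = (\<integral>\<^sup>+x. ennreal (exp (- ((1 + \<eta>) * u\<^sup>2 / 2))) * ennreal (exp (u * (x - 1))) \<partial>std_exp)"
      by (intro nn_integral_cong) (simp add: ennreal_mult[symmetric] exp_add[symmetric])
    also have "\<dots> = ennreal (exp (- ((1 + \<eta>) * u\<^sup>2 / 2))) * ennreal (exp (- u - ln (1 - u)))"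
      using u by (subst nn_integral_cmult) (auto simp: exponential_mgf)
    also have "\<dots> = ennreal (exp (- u - ln (1 - u) - (1 + \<eta>) * u\<^sup>2 / 2))"
      by (simp add: ennreal_mult[symmetric] exp_add[symmetric])
    also have "\<dots> \<le> ennreal 1" using le by (intro ennreal_leI) simp
    finally show "(\<integral>\<^sup>+x. ennreal (exp (u * (x - 1) - (1 + \<eta>) * u\<^sup>2 / 2)) \<partial>std_exp) \<le> 1" by simp
  qed (use d in auto)
qed

abbreviation std_exp_seq :: "(nat \<Rightarrow> real) measure" where
  "std_exp_seq \<equiv> PiM UNIV (\<lambda>_::nat. std_exp)"

interpretation std_exp: prob_space std_exp
  by (rule prob_space_exponential_density) simp

interpretation std_exp_seq: sequence_space std_exp ..

interpretation std_exp_seq: prob_space std_exp_seq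
  by (rule std_exp_seq.P.prob_space_axioms)

text \<open>The maximal inequality on geometric blocks of indices, followed by the first
  Borel-Cantelli lemma. The sign \<open>c = - 1\<close> is needed as well: the lower bound uses it
  to control the sum before a block.\<close>

lemma lil_upper_bound:
  fixes c \<epsilon> :: real
  assumes c: "c = 1 \<or> c = - 1" and "0 < \<epsilon>"
  shows "AE \<omega> in std_exp_seq. \<forall>\<^sub>F n in sequentially.
    c * (\<Sum>i<n. \<omega> i - 1) \<le> (1 + \<epsilon>) * sqrt (2 * real n * ln (ln (real n)))"
proof -
  \<comment> \<open>\<open>\<theta>\<close> is the decay exponent of the block probabilities. Of the
    factor \<open>(1 + \<epsilon>)\<^sup>2\<close> in the squared threshold, one power is spent on
    the ratio of the blocks; the other still beats the variance slack
    \<open>1 + \<epsilon> / 2\<close>, so \<open>\<theta> > 1\<close>.\<close>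
  define L \<theta> where "L = ln (1 + \<epsilon>)" and "\<theta> = (1 + \<epsilon>) / (1 + \<epsilon> / 2)"
  have L: "0 < L" and th: "1 < \<theta>" using \<open>0 < \<epsilon>\<close> by (auto simp: L_def \<theta>_def)
  have eL: "exp L = 1 + \<epsilon>" using \<open>0 < \<epsilon>\<close> by (simp add: L_def)
  obtain l0 where l0: "0 < l0" "\<And>u. \<bar>u\<bar> < l0 \<Longrightarrow>
    (\<integral>\<^sup>+x. ennreal (exp (u * (x - 1) - (1 + \<epsilon> / 2) * u\<^sup>2 / 2)) \<partial>std_exp) \<le> 1"
    using exponential_subgaussian_near_0[of "\<epsilon> / 2"] \<open>0 < \<epsilon>\<close> by auto
  \<comment> \<open>The k-th block runs from \<open>exp (L * k)\<close> to
    \<open>T k = exp (L * (k + 1))\<close>. The threshold is taken at its lower end, where the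
    target bound is smallest.\<close>
  define b where "b k = (1 + \<epsilon>) * sqrt (2 * exp (L * real k) * ln (L * real k))" for k :: nat
  define T where "T k = exp (L * real k) * (1 + \<epsilon>)" for k :: nat
  \<comment> \<open>This multiplier maximises
    \<open>l * b k - T k * (1 + \<epsilon> / 2) * l\<^sup>2 / 2\<close>.\<close>
  define l where "l k = b k / ((1 + \<epsilon> / 2) * T k)" for k
  define A where "A k = {\<omega> \<in> space std_exp_seq. \<exists>j\<le>nat \<lfloor>T k\<rfloor>. b k \<le> c * (\<Sum>i<j. \<omega> i - 1)}" for k
  have [measurable]: "A k \<in> sets std_exp_seq" for k unfolding A_def by measurable
  have T: "0 < T k" for k using \<open>0 < \<epsilon>\<close> by (simp add: T_def)
  \<comment> \<open>The quadratic moment bound is available near 0 only.\<close>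
  have "l \<longlonglongrightarrow> 0" unfolding l_def b_def T_def using L \<open>0 < \<epsilon>\<close> by real_asymp
  hence "\<forall>\<^sub>F k in sequentially. l k < l0" using l0(1) by (rule order_tendstoD)
  moreover have Lk: "\<forall>\<^sub>F k in sequentially. 1 < L * real k" using L by real_asymp
  ultimately have bound: "\<forall>\<^sub>F k in sequentially. measure std_exp_seq (A k) \<le> (L * real k) powr (- \<theta>)"
  proof eventually_elim
    case (elim k)
    have b: "0 < b k" unfolding b_def using \<open>0 < \<epsilon>\<close> elim by simp
    have lk: "0 < l k" unfolding l_def using b T \<open>0 < \<epsilon>\<close> by simp
    define g where "g x = (c * l k) * (x - 1) - (1 + \<epsilon> / 2) * (c * l k)\<^sup>2 / 2" for x
    have c2: "(c * l k)\<^sup>2 = (l k)\<^sup>2" using c by auto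
    have "\<bar>c * l k\<bar> < l0" using c lk elim by auto
    hence int: "(\<integral>\<^sup>+x. ennreal (exp (g x)) \<partial>std_exp) \<le> 1" unfolding g_def by (rule l0(2))
    \<comment> \<open>The level that the sum of the \<open>g (\<omega> i)\<close> must reach:
      \<open>T k\<close> bounds the number of summands, each of which subtracts
      \<open>(1 + \<epsilon> / 2) * (l k)\<^sup>2 / 2\<close>.\<close>
    define a where "a = l k * b k - T k * ((1 + \<epsilon> / 2) * (l k)\<^sup>2 / 2)"
    have "A k \<subseteq> {\<omega> \<in> space std_exp_seq. \<exists>j\<le>nat \<lfloor>T k\<rfloor>. a \<le> (\<Sum>i<j. g (\<omega> i))}"
    proof
      fix \<omega> assume "\<omega> \<in> A k"
      then obtain j where j: "\<omega> \<in> space std_exp_seq" "j \<le> nat \<lfloor>T k\<rfloor>" "b k \<le> c * (\<Sum>i<j. \<omega> i - 1)"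
        unfolding A_def by blast
      have "real j \<le> T k" using j(2) T[of k] by linarith
      hence "real j * ((1 + \<epsilon> / 2) * (l k)\<^sup>2 / 2) \<le> T k * ((1 + \<epsilon> / 2) * (l k)\<^sup>2 / 2)"
        using \<open>0 < \<epsilon>\<close> by (intro mult_right_mono) auto
      moreover have "l k * b k \<le> l k * (c * (\<Sum>i<j. \<omega> i - 1))" using lk j(3) by simp
      moreover have "(\<Sum>i<j. g (\<omega> i)) = l k * (c * (\<Sum>i<j. \<omega> i - 1)) - real j * ((1 + \<epsilon> / 2) * (l k)\<^sup>2 / 2)"
        unfolding g_def c2 sum_subtractf sum_distrib_left[symmetric] by (simp add: sum_subtractf)
      ultimately have "a \<le> (\<Sum>i<j. g (\<omega> i))" unfolding a_def by linarith
      thus "\<omega> \<in> {\<omega> \<in> space std_exp_seq. \<exists>j\<le>nat \<lfloor>T k\<rfloor>. a \<le> (\<Sum>i<j. g (\<omega> i))}" using j by blast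
    qed
    hence "emeasure std_exp_seq (A k) \<le> emeasure std_exp_seq {\<omega> \<in> space std_exp_seq. \<exists>j\<le>nat \<lfloor>T k\<rfloor>. a \<le> (\<Sum>i<j. g (\<omega> i))}"
      unfolding g_def by (intro emeasure_mono) measurable
    also have "\<dots> \<le> ennreal (exp (- a))"
      by (rule std_exp_seq.exponential_maximal_inequality[OF _ int]) (simp add: g_def)
    finally have "measure std_exp_seq (A k) \<le> exp (- a)"
      by (simp add: std_exp_seq.emeasure_eq_measure)
    also have "a = \<theta> * ln (L * real k)"
    proof -
      have "a = (b k)\<^sup>2 / (2 * (1 + \<epsilon> / 2) * T k)"
        unfolding a_def l_def using T[of k] \<open>0 < \<epsilon>\<close> by (simp add: power2_eq_square divide_simps)
      also have "(b k)\<^sup>2 = (1 + \<epsilon>)\<^sup>2 * (2 * exp (L * real k) * ln (L * real k))"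
        unfolding b_def power_mult_distrib using elim by (subst real_sqrt_pow2) auto
      also have "\<dots> / (2 * (1 + \<epsilon> / 2) * T k) = \<theta> * ln (L * real k)"
      proof -
        have cancel: "p * p * (2 * E * y) / (2 * q * (E * p)) = p / q * y"
          if "0 < p" "0 < q" "0 < E" for p q E y :: real using that by simp
        show ?thesis unfolding T_def \<theta>_def power2_eq_square
          using \<open>0 < \<epsilon>\<close> by (intro cancel) auto
      qed
      finally show ?thesis .
    qed
    also have "exp (- (\<theta> * ln (L * real k))) = (L * real k) powr (- \<theta>)"
    proof -
      have "k \<noteq> 0" using elim by (intro notI) simp
      thus ?thesis using L by (simp add: powr_def)
    qed
    finally show ?case .
  qed
  have "summable (\<lambda>k. measure std_exp_seq (A k))"
  proof (rule summable_comparison_test_ev)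
    show "\<forall>\<^sub>F k in sequentially. norm (measure std_exp_seq (A k)) \<le> L powr (- \<theta>) * real k powr (- \<theta>)"
      using bound Lk
    proof eventually_elim
      case (elim k)
      thus ?case using L by (simp add: powr_mult)
    qed
    show "summable (\<lambda>k. L powr (- \<theta>) * real k powr (- \<theta>))"
      using th by (intro summable_mult) (simp add: summable_real_powr_iff)
  qed
  hence "AE \<omega> in std_exp_seq. \<forall>\<^sub>F k in sequentially. \<omega> \<in> space std_exp_seq - A k"
    by (intro borel_cantelli_AE1) (auto simp: std_exp_seq.emeasure_eq_measure less_top[symmetric])
  thus ?thesis
  proof eventually_elim
    case (elim \<omega>)
    obtain K where K: "\<And>k. K \<le> k \<Longrightarrow> \<omega> \<in> space std_exp_seq - A k" "\<And>k. K \<le> k \<Longrightarrow> 1 < L * real k"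
      using eventually_conj[OF elim Lk] unfolding eventually_sequentially by blast
    have "\<forall>\<^sub>F n in sequentially. real K \<le> ln (real n) / L \<and> 1 \<le> n"
      using L by (intro eventually_conj) real_asymp+
    thus ?case
    proof eventually_elim
      case (elim n)
      \<comment> \<open>The index of the block that contains n.\<close>
      define k where "k = nat \<lfloor>ln (real n) / L\<rfloor>"
      have k: "K \<le> k" "real k \<le> ln (real n) / L" "ln (real n) / L < real k + 1"
        using elim unfolding k_def by linarith+
      have k1: "L * real k \<le> ln (real n)" "ln (real n) < L * real k + L"
        using k(2,3) L by (auto simp: field_simps)
      have n: "0 < real n" using elim by simp
      have e1: "exp (L * real k) \<le> real n" using k1(1) n by (metis exp_le_cancel_iff exp_ln)
      have "real n < exp (L * real k + L)" using k1(2) n by (metis exp_less_cancel_iff exp_ln)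
      hence "real n < T k" by (simp add: T_def exp_add eL)
      hence "n \<le> nat \<lfloor>T k\<rfloor>" by (simp add: le_nat_floor)
      moreover have "\<omega> \<in> space std_exp_seq - A k" using K k by blast
      ultimately have "c * (\<Sum>i<n. \<omega> i - 1) < b k" unfolding A_def by force
      also have "b k \<le> (1 + \<epsilon>) * sqrt (2 * real n * ln (ln (real n)))"
        unfolding b_def using K(2)[OF k(1)] k1 e1 \<open>0 < \<epsilon>\<close>
        by (intro mult_left_mono real_sqrt_le_mono mult_mono ln_mono) auto
      finally show ?case by simp
    qed
  qed
qed

section \<open>The law of the iterated logarithm for exponential variables: lower bound\<close>

text \<open>The upper half of Stirling's formula with constant e. The induction step amounts to
  \<open>(n + 1/2) * (ln (n + 1) - ln n) \<ge> 1\<close>.\<close>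

lemma ln_fact_le:
  assumes "1 \<le> n"
  shows "ln (fact n :: real) \<le> 1 + (real n + 1 / 2) * ln (real n) - real n"
  using assms
proof (induction n rule: dec_induct)
  case (step n)
  have n: "0 < real n" using step by simp
  have "2 * (1 / (real n + real (Suc n))) \<le> ln (real (Suc n)) - ln (real n)"
    using ln_inverse_approx_ge[of "real n" "real (Suc n)"] n by simp
  hence "2 * (1 / (real n + real (Suc n))) * (real n + 1 / 2) \<le> (ln (real (Suc n)) - ln (real n)) * (real n + 1 / 2)"
    using n by (intro mult_right_mono) auto
  moreover have "2 * (1 / (real n + real (Suc n))) * (real n + 1 / 2) = 1"
    using n by (simp add: field_simps)
  moreover have "ln (fact (Suc n) :: real) = ln (real (Suc n)) + ln (fact n)"
    using n by (simp only: fact_Suc of_nat_mult) (subst ln_mult, auto)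
  ultimately show ?case using step.IH by (simp add: algebra_simps)
qed simp

lemma ln_one_plus_ge_quadratic:
  fixes u :: real
  assumes "0 \<le> u"
  shows "u - u\<^sup>2 / 2 \<le> ln (1 + u)"
proof -
  have "ln (1 + 0) - 0 + 0\<^sup>2 / 2 \<le> ln (1 + u) - u + u\<^sup>2 / 2"
  proof (rule DERIV_nonneg_imp_nondecreasing[OF assms])
    fix x :: real assume x: "0 \<le> x" "x \<le> u"
    have "((\<lambda>u. ln (1 + u) - u + u\<^sup>2 / 2) has_real_derivative (1 / (1 + x) - 1 + x)) (at x)"
      using x by (auto intro!: derivative_eq_intros)
    moreover have "1 / (1 + x) - 1 + x = x\<^sup>2 / (1 + x)"
    proof -
      have "1 + x \<noteq> 0" using x by linarith
      thus ?thesis by (simp add: divide_simps power2_eq_square) (simp add: algebra_simps)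
    qed
    ultimately show "\<exists>y. ((\<lambda>u. ln (1 + u) - u + u\<^sup>2 / 2) has_real_derivative y) (at x) \<and> 0 \<le> y"
      using x by (intro exI[of _ "1 / (1 + x) - 1 + x"]) auto
  qed
  thus ?thesis by simp
qed

text \<open>A Gaussian lower bound for Poisson probabilities: Stirling's formula leaves
  \<open>j * ln (x / j) - (x - j)\<close>, and the quadratic bound for \<open>ln (1 + u)\<close> at
  \<open>u = (x - j) / j\<close> turns this into the exponent.\<close>

lemma poisson_term_ge:
  fixes x :: real
  assumes "1 \<le> j" "real j \<le> x"
  shows "exp (- 1 - (x - real j)\<^sup>2 / (2 * real j)) / sqrt (real j) \<le> x ^ j * exp (- x) / fact j"
proof -
  have j: "0 < real j" and x: "0 < x" using assms by auto
  define u where "u = (x - real j) / real j"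
  have "u - u\<^sup>2 / 2 \<le> ln (1 + u)" using assms j by (intro ln_one_plus_ge_quadratic) (simp add: u_def)
  moreover have "1 + u = x / real j" using j by (simp add: u_def diff_divide_distrib)
  ultimately have "real j * (u - u\<^sup>2 / 2) \<le> real j * (ln x - ln (real j))"
    using j x by (intro mult_left_mono) (auto simp: ln_divide_pos)
  moreover have "real j * u = x - real j" "real j * (u\<^sup>2 / 2) = (x - real j)\<^sup>2 / (2 * real j)"
    using j unfolding u_def by (auto simp: power2_eq_square)
  ultimately have 1: "x - real j - (x - real j)\<^sup>2 / (2 * real j) \<le> real j * ln x - real j * ln (real j)"
    by (simp add: right_diff_distrib)
  have "- 1 - (x - real j)\<^sup>2 / (2 * real j) - ln (real j) / 2 \<le> real j * ln x - x - ln (fact j)"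
    using ln_fact_le[OF assms(1)] 1 by (simp add: algebra_simps)
  hence "exp (- 1 - (x - real j)\<^sup>2 / (2 * real j) - ln (real j) / 2) \<le> exp (real j * ln x - x - ln (fact j))"
    by simp
  also have "exp (real j * ln x - x - ln (fact j)) = x ^ j * exp (- x) / fact j"
    using x by (simp add: exp_diff exp_minus exp_of_nat_mult divide_inverse)
  also have "exp (- 1 - (x - real j)\<^sup>2 / (2 * real j) - ln (real j) / 2)
      = exp (- 1 - (x - real j)\<^sup>2 / (2 * real j)) / sqrt (real j)"
    using j by (simp add: exp_diff ln_sqrt[symmetric])
  finally show ?thesis .
qed

text \<open>Only the last m terms are kept, with m about \<open>sqrt N\<close>. Each carries a
  factor \<open>1 / sqrt N\<close>, which their number cancels. As
  \<open>N - j \<le> m \<le> sqrt N + 1\<close> for these terms, one common Gaussian exponent serves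
  all of them.\<close>

lemma poisson_sum_ge:
  fixes t :: real
  assumes "0 \<le> t" and N: "0 < real N - sqrt (real N) - 1"
  shows "exp (- 1 - (t + sqrt (real N) + 1)\<^sup>2 / (2 * (real N - sqrt (real N) - 1)))
    \<le> (\<Sum>j\<le>N - 1. (real N + t) ^ j * exp (- (real N + t)) / fact j)"
proof -
  define m where "m = nat \<lceil>sqrt (real N)\<rceil>"
  have N1: "1 \<le> N" using N by (cases N) auto
  have sN: "1 \<le> sqrt (real N)" using N1 by simp
  have m: "sqrt (real N) \<le> real m" "real m \<le> sqrt (real N) + 1"
    using sN unfolding m_def by linarith+
  have mN: "m < N" using m N by linarith
  define D where "D = (t + sqrt (real N) + 1)\<^sup>2 / (2 * (real N - sqrt (real N) - 1))"
  have tm: "exp (- 1 - D) / sqrt (real N) \<le> (real N + t) ^ j * exp (- (real N + t)) / fact j"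
    if "j \<in> {N - m..<N}" for j
  proof -
    have j: "1 \<le> j" "j \<le> N" "real N - real m \<le> real j" using that mN by auto
    have "(real N + t - real j)\<^sup>2 / (2 * real j) \<le> D" unfolding D_def
      using j m N \<open>0 \<le> t\<close> by (intro frac_le power_mono) auto
    hence "exp (- 1 - D) / sqrt (real N) \<le> exp (- 1 - (real N + t - real j)\<^sup>2 / (2 * real j)) / sqrt (real j)"
      using j by (intro frac_le) auto
    also have "\<dots> \<le> (real N + t) ^ j * exp (- (real N + t)) / fact j"
      using j \<open>0 \<le> t\<close> by (intro poisson_term_ge) auto
    finally show ?thesis .
  qed
  have "exp (- 1 - D) = sqrt (real N) * (exp (- 1 - D) / sqrt (real N))" using sN by simp
  also have "\<dots> \<le> real m * (exp (- 1 - D) / sqrt (real N))"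
    using m by (intro mult_right_mono) auto
  also have "\<dots> = (\<Sum>j\<in>{N - m..<N}. exp (- 1 - D) / sqrt (real N))" using mN by simp
  also have "\<dots> \<le> (\<Sum>j\<in>{N - m..<N}. (real N + t) ^ j * exp (- (real N + t)) / fact j)"
    by (intro sum_mono tm)
  also have "\<dots> \<le> (\<Sum>j\<le>N - 1. (real N + t) ^ j * exp (- (real N + t)) / fact j)"
    using \<open>0 \<le> t\<close> by (intro sum_mono2) auto
  finally show ?thesis unfolding D_def .
qed

lemma std_exp_seq_indep:
  "std_exp_seq.indep_vars (\<lambda>_. std_exp) (\<lambda>i \<omega>. \<omega> i) UNIV"
proof (subst std_exp_seq.indep_vars_iff_distr_eq_PiM')
  have "distr std_exp_seq std_exp (\<lambda>\<omega>. \<omega> i) = std_exp" for i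
    by (rule distr_PiM_component) (auto intro: std_exp.prob_space_axioms)
  moreover have "distr std_exp_seq std_exp_seq (\<lambda>x. \<lambda>i\<in>UNIV. x i) = std_exp_seq"
    by (simp add: restrict_UNIV distr_id2)
  ultimately show "distr std_exp_seq std_exp_seq (\<lambda>x. \<lambda>i\<in>UNIV. x i) =
      (\<Pi>\<^sub>M i\<in>UNIV. distr std_exp_seq std_exp (\<lambda>\<omega>. \<omega> i))" by simp
qed auto

lemma std_exp_seq_distributed:
  "distributed std_exp_seq lborel (\<lambda>\<omega>. \<omega> i) (exponential_density 1)"
proof -
  have "distr std_exp_seq std_exp (\<lambda>\<omega>. \<omega> i) = std_exp"
    by (rule distr_PiM_component) (auto intro: std_exp.prob_space_axioms)
  moreover have "distr std_exp_seq std_exp (\<lambda>\<omega>. \<omega> i) = distr std_exp_seq lborel (\<lambda>\<omega>. \<omega> i)"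
    by (rule distr_cong) auto
  ultimately show ?thesis unfolding distributed_def by auto
qed

text \<open>With N the number of summands, the sum of the variables exceeds \<open>N + t\<close>
  with the probability that a Poisson variable of mean \<open>N + t\<close> is at most
  \<open>N - 1\<close>.\<close>

lemma std_exp_block_tail:
  fixes t :: real
  assumes I: "finite I" and t: "0 \<le> t" and N: "0 < real (card I) - sqrt (real (card I)) - 1"
  shows "exp (- 1 - (t + sqrt (real (card I)) + 1)\<^sup>2 / (2 * (real (card I) - sqrt (real (card I)) - 1)))
    \<le> measure std_exp_seq {\<omega> \<in> space std_exp_seq. t < (\<Sum>i\<in>I. \<omega> i - 1)}"
proof -
  have ne: "I \<noteq> {}" using N by auto
  have ind: "std_exp_seq.indep_vars (\<lambda>_. borel) (\<lambda>i \<omega>. \<omega> i) I"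
    using std_exp_seq.indep_vars_compose2[OF std_exp_seq.indep_vars_subset[OF std_exp_seq_indep], of I "\<lambda>_ x. x" "\<lambda>_. borel"]
    by simp
  \<comment> \<open>The Erlang density with index k belongs to \<open>k + 1\<close>
    summands.\<close>
  have D: "distributed std_exp_seq lborel (\<lambda>\<omega>. \<Sum>i\<in>I. \<omega> i) (erlang_density (card I - 1) 1)"
    using I ne ind std_exp_seq_distributed by (intro std_exp_seq.exponential_distributed_sum) auto
  have "measure std_exp_seq {\<omega> \<in> space std_exp_seq. t < (\<Sum>i\<in>I. \<omega> i - 1)}
      = measure std_exp_seq {\<omega> \<in> space std_exp_seq. real (card I) + t < (\<Sum>i\<in>I. \<omega> i)}"
    by (simp add: sum_subtractf less_diff_eq add.commute)
  also have "\<dots> = 1 - erlang_CDF (card I - 1) 1 (real (card I) + t)"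
    using t by (intro std_exp_seq.erlang_distributed_gt[OF D]) auto
  also have "\<dots> = (\<Sum>j\<le>card I - 1. (real (card I) + t) ^ j * exp (- (real (card I) + t)) / fact j)"
    using t by (simp add: erlang_CDF_def)
  finally show ?thesis using poisson_sum_ge[OF t N] by simp
qed

text \<open>The second Borel-Cantelli lemma, stated for random variables so that independence of
  blocks can be used directly. If avoiding all events from m on had probability q > 0, the partial
  sums of the probabilities would be at most \<open>m - ln q\<close>.\<close>

lemma (in prob_space) borel_cantelli_second:
  assumes ind: "indep_vars N X (UNIV :: nat set)"
    and P: "\<And>i. {x \<in> space (N i). P i x} \<in> sets (N i)"
    and div: "\<not> summable (\<lambda>i. prob {x \<in> space M. P i (X i x)})"
  shows "AE x in M. \<exists>\<^sub>F i in sequentially. P i (X i x)"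
proof -
  have X: "X i \<in> measurable M (N i)" for i using ind unfolding indep_vars_def by auto
  have E [measurable]: "{x \<in> space M. P i (X i x)} \<in> events" for i
  proof -
    have "{x \<in> space M. P i (X i x)} = X i -` {x \<in> space (N i). P i x} \<inter> space M"
      using measurable_space[OF X] by auto
    thus ?thesis using measurable_sets[OF X P] by simp
  qed
  have nP: "{x \<in> space (N i). \<not> P i x} \<in> sets (N i)" for i
    using sets.compl_sets[OF P[of i]] by (rule back_subst[of "\<lambda>A. A \<in> _"]) auto
  have indc: "indep_events (\<lambda>i. {x \<in> space M. \<not> P i (X i x)}) UNIV"
    by (rule indep_eventsI_indep_vars[OF ind nP])
  let ?p = "\<lambda>i. prob {x \<in> space M. P i (X i x)}"
  \<comment> \<open>Dropping the first m probabilities, each at most 1, costs at most m in the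
    exponent. For \<open>n \<le> m\<close> the right-hand side is at least 1.\<close>
  have fin: "prob {x \<in> space M. \<forall>i\<ge>m. \<not> P i (X i x)} \<le> exp (real m - (\<Sum>i<n. ?p i))" for m n
  proof (cases "m < n")
    case True
    have "prob {x \<in> space M. \<forall>i\<ge>m. \<not> P i (X i x)} \<le> prob (\<Inter>i\<in>{m..<n}. {x \<in> space M. \<not> P i (X i x)})"
      using True by (intro finite_measure_mono sets.finite_INT) auto
    also have "\<dots> = (\<Prod>i\<in>{m..<n}. prob {x \<in> space M. \<not> P i (X i x)})"
      using indc True unfolding indep_events_def by auto
    also have "\<dots> = (\<Prod>i\<in>{m..<n}. 1 - ?p i)"
    proof (intro prod.cong refl)
      fix i
      have "{x \<in> space M. \<not> P i (X i x)} = space M - {x \<in> space M. P i (X i x)}" by auto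
      thus "prob {x \<in> space M. \<not> P i (X i x)} = 1 - ?p i" by (simp add: prob_compl)
    qed
    also have "\<dots> \<le> (\<Prod>i\<in>{m..<n}. exp (- ?p i))"
      using exp_ge_add_one_self[of "- ?p i" for i] by (intro prod_mono) auto
    also have "\<dots> = exp (- (\<Sum>i\<in>{m..<n}. ?p i))" by (simp add: exp_sum sum_negf[symmetric])
    also have "(\<Sum>i\<in>{m..<n}. ?p i) = (\<Sum>i<n. ?p i) - (\<Sum>i<m. ?p i)"
      using sum_diff_nat_ivl[of 0 m n ?p] True by (simp add: atLeast0LessThan)
    also have "exp (- ((\<Sum>i<n. ?p i) - (\<Sum>i<m. ?p i))) \<le> exp (real m - (\<Sum>i<n. ?p i))"
      using sum_bounded_above[of "{..<m}" ?p 1] by simp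
    finally show ?thesis .
  next
    case False
    hence "(\<Sum>i<n. ?p i) \<le> real m" using sum_bounded_above[of "{..<n}" ?p 1] by simp
    hence "1 \<le> exp (real m - (\<Sum>i<n. ?p i))" by simp
    thus ?thesis using prob_le_1 order_trans by blast
  qed
  have zero: "prob {x \<in> space M. \<forall>i\<ge>m. \<not> P i (X i x)} = 0" for m
  proof (rule ccontr)
    let ?q = "prob {x \<in> space M. \<forall>i\<ge>m. \<not> P i (X i x)}"
    assume "?q \<noteq> 0"
    hence q: "0 < ?q" by (simp add: zero_less_measure_iff)
    have "(\<Sum>i<n. ?p i) \<le> real m - ln ?q" for n
    proof -
      have "ln ?q \<le> ln (exp (real m - (\<Sum>i<n. ?p i)))" using fin[of m n] q by (intro ln_mono) auto
      thus ?thesis by simp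
    qed
    hence "summable ?p" by (intro summableI_nonneg_bounded) auto
    thus False using div by simp
  qed
  have "AE x in M. \<not> (\<forall>i\<ge>m. \<not> P i (X i x))" for m
    by (rule AE_I'[of "{x \<in> space M. \<forall>i\<ge>m. \<not> P i (X i x)}"])
      (auto simp: null_sets_def emeasure_eq_measure zero)
  hence "AE x in M. \<forall>m. \<not> (\<forall>i\<ge>m. \<not> P i (X i x))" by (simp add: AE_all_countable)
  thus ?thesis by eventually_elim (auto simp: frequently_sequentially)
qed

text \<open>The increments over disjoint blocks are independent, and the probability that the k-th
  one is large is at least a constant times \<open>1 / (k + 1)\<close>, whose sum diverges.\<close>

lemma lil_lower_blocks:
  fixes \<epsilon> :: real and K :: nat
  assumes K: "2 \<le> K" and e: "0 < \<epsilon>" "\<epsilon> < 1"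
  shows "AE \<omega> in std_exp_seq. \<exists>\<^sub>F k in sequentially.
    (1 - \<epsilon>) * sqrt (2 * (real K ^ Suc k - real K ^ k) * ln (ln (real K ^ Suc k)))
      < (\<Sum>i\<in>{K ^ k..<K ^ Suc k}. \<omega> i - 1)"
proof -
  define I where "I k = {K ^ k..<K ^ Suc k}" for k
  define N where "N k = real K ^ Suc k - real K ^ k" for k
  define L where "L k = ln (ln (real K ^ Suc k))" for k
  define t where "t k = (1 - \<epsilon>) * sqrt (2 * N k * L k)" for k
  have card: "real (card (I k)) = N k" for k
    using K by (simp add: I_def N_def of_nat_diff)
  have Nlim: "filterlim N at_top sequentially"
  proof (rule filterlim_at_top_mono)
    show "filterlim (\<lambda>k. real K ^ k) at_top sequentially"
      using K by real_asymp
    have "real K ^ k * 1 \<le> real K ^ k * (real K - 1)" for k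
      using K by (intro mult_left_mono) auto
    thus "\<forall>\<^sub>F k in sequentially. real K ^ k \<le> N k" by (simp add: N_def algebra_simps)
  qed
  have lnK: "0 < ln (real K)" using K by simp
  have L_eq: "L k = ln (real (Suc k) * ln (real K))" for k
    using K unfolding L_def by (subst ln_realpow) auto
  have Llim: "filterlim L at_top sequentially" unfolding L_eq using lnK by real_asymp
  \<comment> \<open>The Gaussian exponent of the block tail divided by \<open>L k\<close>, expressed
    through quantities that tend to 0. Its limit \<open>(1 - \<epsilon>)\<^sup>2\<close> is below 1,
    so the exponent is eventually at most \<open>L k\<close>.\<close>
  define F where "F = (\<lambda>k. ((1 - \<epsilon>) * sqrt 2 + 1 / sqrt (L k) * (1 + 1 / sqrt (N k)))\<^sup>2 /
      (2 * (1 - 1 / sqrt (N k) - (1 / sqrt (N k))\<^sup>2)))"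
  have inv: "(\<lambda>k. 1 / sqrt (f k)) \<longlonglongrightarrow> 0" if "filterlim f at_top sequentially" for f :: "nat \<Rightarrow> real"
    using tendsto_inverse_0_at_top[OF filterlim_compose[OF sqrt_at_top that]] by (simp add: inverse_eq_divide)
  have "F \<longlonglongrightarrow> ((1 - \<epsilon>) * sqrt 2 + 0 * (1 + 0))\<^sup>2 / (2 * (1 - 0 - 0\<^sup>2))"
    unfolding F_def by (intro tendsto_intros inv Nlim Llim) auto
  also have "((1 - \<epsilon>) * sqrt 2 + 0 * (1 + 0))\<^sup>2 / (2 * (1 - 0 - 0\<^sup>2)) = (1 - \<epsilon>)\<^sup>2"
    by (simp add: power_mult_distrib)
  finally have "F \<longlonglongrightarrow> (1 - \<epsilon>)\<^sup>2" .
  moreover have "(1 - \<epsilon>)\<^sup>2 < 1" using e by (simp add: abs_square_less_1)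
  ultimately have "\<forall>\<^sub>F k in sequentially. F k < 1" by (rule order_tendstoD)
  moreover have "\<forall>\<^sub>F k in sequentially. 4 < N k" using Nlim by (simp add: filterlim_at_top_dense)
  moreover have "\<forall>\<^sub>F k in sequentially. 0 < L k" using Llim by (simp add: filterlim_at_top_dense)
  ultimately have prob: "\<forall>\<^sub>F k in sequentially. exp (- 1) / ln (real K) * (1 / real (Suc k))
      \<le> measure std_exp_seq {\<omega> \<in> space std_exp_seq. t k < (\<Sum>i\<in>I k. \<omega> i - 1)}"
  proof eventually_elim
    case (elim k)
    define s where "s = sqrt (N k)"
    define v where "v = sqrt (L k)"
    have s: "2 < s" "s\<^sup>2 = N k" using elim real_less_rsqrt[of 2 "N k"] unfolding s_def by auto
    have v: "0 < v" "v\<^sup>2 = L k" using elim unfolding v_def by auto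
    have "2 * s < s * s" using s(1) by (intro mult_strict_right_mono) auto
    hence "2 * s < N k" unfolding s(2)[symmetric] power2_eq_square .
    hence D: "0 < N k - s - 1" using s(1) by linarith
    have tk: "t k = (1 - \<epsilon>) * sqrt 2 * s * v" unfolding t_def s_def v_def by (simp add: real_sqrt_mult)
    have "(t k + s + 1)\<^sup>2 / (2 * (N k - s - 1)) = L k * F k"
    proof -
      have "t k + s + 1 = (s * v) * ((1 - \<epsilon>) * sqrt 2 + 1 / v * (1 + 1 / s))"
        using s v unfolding tk by (simp add: field_simps)
      moreover have "N k - s - 1 = s\<^sup>2 * (1 - 1 / s - (1 / s)\<^sup>2)"
        using s(1) unfolding s(2)[symmetric] by (simp add: right_diff_distrib power2_eq_square)
      ultimately show ?thesis unfolding F_def s_def[symmetric] v_def[symmetric] v(2)[symmetric]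
        using s(1) v(1) by (simp add: power_mult_distrib)
    qed
    also have "\<dots> \<le> L k" using elim by simp
    finally have "exp (- 1 - L k) \<le> exp (- 1 - (t k + s + 1)\<^sup>2 / (2 * (N k - s - 1)))" by simp
    also have "\<dots> \<le> measure std_exp_seq {\<omega> \<in> space std_exp_seq. t k < (\<Sum>i\<in>I k. \<omega> i - 1)}"
      using std_exp_block_tail[of "I k" "t k"] D tk s v e unfolding card s_def by (simp add: I_def)
    \<comment> \<open>Here \<open>L k\<close> is the logarithm of \<open>(k + 1) * ln K\<close>,
      which produces the harmonic series.\<close>
    also have "exp (- 1 - L k) = exp (- 1) / ln (real K) * (1 / real (Suc k))"
      using lnK unfolding L_eq by (simp add: exp_diff)
    finally show ?case .
  qed
  have "disjoint_family I"
  proof -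
    have "I a \<inter> I b = {}" if "a < b" for a b
    proof -
      have "K ^ Suc a \<le> K ^ b" using K that by (intro power_increasing) auto
      thus ?thesis unfolding I_def by auto
    qed
    thus ?thesis unfolding disjoint_family_on_def by (metis inf_commute nat_neq_iff)
  qed
  hence ind: "std_exp_seq.indep_vars (\<lambda>j. PiM (I j) (\<lambda>_. std_exp)) (\<lambda>j \<omega>. restrict (\<lambda>i. \<omega> i) (I j)) UNIV"
    by (intro std_exp_seq.indep_vars_restrict[OF std_exp_seq_indep]) auto
  \<comment> \<open>The restriction exhibits the k-th event as a condition on the k-th independent
    block vector alone.\<close>
  have "AE \<omega> in std_exp_seq. \<exists>\<^sub>F k in sequentially. t k < (\<Sum>i\<in>I k. restrict (\<lambda>i. \<omega> i) (I k) i - 1)"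
  proof (rule std_exp_seq.borel_cantelli_second[OF ind])
    show "{x \<in> space (PiM (I k) (\<lambda>_. std_exp)). t k < (\<Sum>i\<in>I k. x i - 1)} \<in> sets (PiM (I k) (\<lambda>_. std_exp))" for k
    proof -
      have [measurable]: "(\<lambda>x. x i) \<in> borel_measurable (PiM (I k) (\<lambda>_. std_exp))" if "i \<in> I k" for i
        using measurable_component_singleton[OF that, of "\<lambda>_. std_exp"] by simp
      show ?thesis by measurable
    qed
    show "\<not> summable (\<lambda>k. measure std_exp_seq {\<omega> \<in> space std_exp_seq. t k < (\<Sum>i\<in>I k. restrict (\<lambda>i. \<omega> i) (I k) i - 1)})"
    proof
      assume "summable (\<lambda>k. measure std_exp_seq {\<omega> \<in> space std_exp_seq. t k < (\<Sum>i\<in>I k. restrict (\<lambda>i. \<omega> i) (I k) i - 1)})"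
      moreover have "\<forall>\<^sub>F k in sequentially. norm (exp (- 1) / ln (real K) * (1 / real (Suc k))) \<le>
        measure std_exp_seq {\<omega> \<in> space std_exp_seq. t k < (\<Sum>i\<in>I k. restrict (\<lambda>i. \<omega> i) (I k) i - 1)}"
        using prob lnK by simp
      ultimately have "summable (\<lambda>k. exp (- 1) / ln (real K) * (1 / real (Suc k)))"
        by (rule summable_comparison_test_ev[rotated])
      moreover have "exp (- 1) / ln (real K) \<noteq> 0" using lnK by simp
      ultimately have "summable (\<lambda>k. 1 / real (Suc k))" by (rule summable_mult_D)
      hence "summable (\<lambda>k. 1 / real k)" by (rule summable_Suc_iff[THEN iffD1])
      thus False using not_summable_harmonic[where 'a = real] by (simp add: inverse_eq_divide)
    qed
  qed
  thus ?thesis by (simp add: t_def N_def L_def I_def)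
qed

text \<open>At \<open>n = K ^ Suc k\<close> the sum is the increment of the last block plus the sum
  up to \<open>n / K\<close>. The upper bound for the negated sums shows that the latter is no worse
  than a multiple of \<open>1 / sqrt K\<close> of the target, which a large K makes
  negligible.\<close>

lemma lil_lower_bound:
  fixes \<epsilon> :: real
  assumes e: "0 < \<epsilon>" "\<epsilon> < 1"
  shows "AE \<omega> in std_exp_seq. \<exists>\<^sub>F n in sequentially.
    (1 - \<epsilon>) * sqrt (2 * real n * ln (ln (real n))) \<le> (\<Sum>i<n. \<omega> i - 1)"
proof -
  let ?h = "\<lambda>x. sqrt (2 * x * ln (ln x))"
  \<comment> \<open>This quantity selects K: \<open>sqrt (1 - 1 / x)\<close> is the loss from the
    block being shorter than n, and \<open>2 / sqrt x\<close> the loss from the initial segment,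
    where 2 is the constant of the upper bound with \<open>\<epsilon> = 1\<close>.\<close>
  have "((\<lambda>x::real. (1 - \<epsilon> / 2) * sqrt (1 - 1 / x) - 2 / sqrt x) \<longlongrightarrow> 1 - \<epsilon> / 2) at_top" by real_asymp
  hence "\<forall>\<^sub>F x in at_top. 1 - \<epsilon> < (1 - \<epsilon> / 2) * sqrt (1 - 1 / x) - 2 / sqrt x"
    using e by (intro order_tendstoD) auto
  then obtain x0 where x0: "\<And>x. x0 \<le> x \<Longrightarrow> 1 - \<epsilon> < (1 - \<epsilon> / 2) * sqrt (1 - 1 / x) - 2 / sqrt x"
    by (auto simp: eventually_at_top_linorder)
  define K where "K = max 2 (nat \<lceil>x0\<rceil>)"
  have K: "2 \<le> K" and Kx: "1 - \<epsilon> < (1 - \<epsilon> / 2) * sqrt (1 - 1 / real K) - 2 / sqrt (real K)"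
    unfolding K_def by (auto intro!: x0, linarith)
  have lnK: "0 < ln (real K)" using K by simp
  have pow: "filterlim (\<lambda>k. K ^ k) at_top sequentially"
    using K by (intro filterlim_subseq strict_monoI power_strict_increasing) auto
  \<comment> \<open>Makes \<open>ln (ln (K ^ k))\<close> positive, as the comparison of the square
    roots requires.\<close>
  have big: "\<forall>\<^sub>F k in sequentially. 1 < real k * ln (real K)" using lnK by real_asymp
  have "AE \<omega> in std_exp_seq. \<forall>\<^sub>F n in sequentially. - 1 * (\<Sum>i<n. \<omega> i - 1) \<le> (1 + 1) * ?h (real n)"
    by (rule lil_upper_bound) auto
  moreover have "AE \<omega> in std_exp_seq. \<exists>\<^sub>F k in sequentially.
    (1 - \<epsilon> / 2) * sqrt (2 * (real K ^ Suc k - real K ^ k) * ln (ln (real K ^ Suc k)))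
      < (\<Sum>i\<in>{K ^ k..<K ^ Suc k}. \<omega> i - 1)"
    using K e by (intro lil_lower_blocks) auto
  ultimately show ?thesis
  proof eventually_elim
    case (elim \<omega>)
    have "\<forall>\<^sub>F k in sequentially. - 1 * (\<Sum>i<K ^ k. \<omega> i - 1) \<le> (1 + 1) * ?h (real (K ^ k))"
      using elim(1) pow by (rule eventually_compose_filterlim)
    from eventually_conj[OF this big] have "\<exists>\<^sub>F k in sequentially.
       ((1 - \<epsilon> / 2) * sqrt (2 * (real K ^ Suc k - real K ^ k) * ln (ln (real K ^ Suc k)))
      < (\<Sum>i\<in>{K ^ k..<K ^ Suc k}. \<omega> i - 1)) \<and> (- 1 * (\<Sum>i<K ^ k. \<omega> i - 1) \<le> (1 + 1) * ?h (real (K ^ k))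
      \<and> 1 < real k * ln (real K))"
      by (intro frequently_rev_mp[OF elim(2)]) (erule eventually_mono, blast)
    hence "\<exists>\<^sub>F k in sequentially. (1 - \<epsilon>) * ?h (real (K ^ Suc k)) \<le> (\<Sum>i<K ^ Suc k. \<omega> i - 1)"
    proof (rule frequently_mono[rotated], safe)
      fix k
      assume a: "(1 - \<epsilon> / 2) * sqrt (2 * (real K ^ Suc k - real K ^ k) * ln (ln (real K ^ Suc k)))
          < (\<Sum>i\<in>{K ^ k..<K ^ Suc k}. \<omega> i - 1)"
        "- 1 * (\<Sum>i<K ^ k. \<omega> i - 1) \<le> (1 + 1) * ?h (real (K ^ k))" "1 < real k * ln (real K)"
      define n where "n = real K ^ Suc k"
      have n: "0 < n" "real K ^ k = n / real K" using K by (auto simp: n_def)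
      have ln1: "ln (real K ^ k) = real k * ln (real K)" using K by (simp add: ln_realpow)
      have ln2: "ln (real K ^ k) \<le> ln n" unfolding n_def using K by (intro ln_mono power_increasing) auto
      have "?h (real K ^ k) \<le> sqrt (2 * (n / real K) * ln (ln n))"
        using a(3) ln1 ln2 n K by (intro real_sqrt_le_mono mult_mono) (auto intro!: ln_mono)
      also have "\<dots> = ?h n / sqrt (real K)" by (simp add: real_sqrt_divide[symmetric])
      finally have 1: "?h (real K ^ k) \<le> ?h n / sqrt (real K)" .
      have "2 * (n - n / real K) * ln (ln n) = (1 - 1 / real K) * (2 * n * ln (ln n))"
        by (simp add: algebra_simps)
      hence 2: "sqrt (2 * (n - n / real K) * ln (ln n)) = sqrt (1 - 1 / real K) * ?h n"
        by (simp only: real_sqrt_mult)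
      have h0: "0 \<le> ?h n" using a(3) ln1 ln2 n(1) by simp
      have "(1 - \<epsilon>) * ?h n \<le> ((1 - \<epsilon> / 2) * sqrt (1 - 1 / real K) - 2 / sqrt (real K)) * ?h n"
        using Kx h0 by (intro mult_right_mono) auto
      also have "\<dots> = (1 - \<epsilon> / 2) * (sqrt (1 - 1 / real K) * ?h n) - 2 * (?h n / sqrt (real K))"
        by (simp add: algebra_simps)
      also have "\<dots> \<le> (\<Sum>i\<in>{K ^ k..<K ^ Suc k}. \<omega> i - 1) + (\<Sum>i<K ^ k. \<omega> i - 1)"
      proof -
        have "p - 2 * r \<le> y + z" if "p < y" "- 1 * z \<le> (1 + 1) * q" "q \<le> r" for p q r y z :: real
        proof -
          have "- z \<le> 2 * q" using that(2) by simp
          thus ?thesis using that(1,3) by linarith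
        qed
        from this[OF a(1)[folded n_def, unfolded n(2) 2] a(2)[unfolded of_nat_power] 1]
        show ?thesis .
      qed
      also have "\<dots> = (\<Sum>i<K ^ Suc k. \<omega> i - 1)"
      proof -
        have "K ^ k \<le> K ^ Suc k" using K by (intro power_increasing) auto
        thus ?thesis using sum.atLeastLessThan_concat[of 0 "K ^ k" "K ^ Suc k" "\<lambda>i. \<omega> i - 1"]
          by (simp only: atLeast0LessThan add.commute)
      qed
      finally show "(1 - \<epsilon>) * ?h (real (K ^ Suc k)) \<le> (\<Sum>i<K ^ Suc k. \<omega> i - 1)"
        by (simp only: n_def of_nat_power)
    qed
    moreover have "filterlim (\<lambda>k. K ^ Suc k) at_top sequentially"
      using filterlim_compose[OF pow filterlim_Suc] by simp
    ultimately show ?case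
      using eventually_compose_filterlim[of "\<lambda>n. \<not> (1 - \<epsilon>) * ?h (real n) \<le> (\<Sum>i<n. \<omega> i - 1)"]
      unfolding frequently_def by blast
  qed
qed

lemma lil_std_exp:
  "AE \<omega> in std_exp_seq.
    limsup (\<lambda>n. ereal ((\<Sum>i<n. \<omega> i - 1) / sqrt (2 * real n * ln (ln (real n))))) = 1"
proof -
  let ?h = "\<lambda>n. sqrt (2 * real n * ln (ln (real n)))"
  have h: "\<forall>\<^sub>F n in sequentially. 0 < ?h n" by real_asymp
  \<comment> \<open>Countably many tolerances are used so that the exceptional null sets can be
    united; in the lower bound \<open>Suc (Suc p)\<close> keeps the tolerance below 1.\<close>
  have "AE \<omega> in std_exp_seq. \<forall>p. \<forall>\<^sub>F n in sequentially. 1 * (\<Sum>i<n. \<omega> i - 1) \<le> (1 + 1 / real (Suc p)) * ?h n"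
    unfolding AE_all_countable by (intro allI lil_upper_bound) auto
  moreover have "AE \<omega> in std_exp_seq. \<forall>p. \<exists>\<^sub>F n in sequentially. (1 - 1 / real (Suc (Suc p))) * ?h n \<le> (\<Sum>i<n. \<omega> i - 1)"
    unfolding AE_all_countable by (intro allI lil_lower_bound) auto
  ultimately show ?thesis
  proof eventually_elim
    case (elim \<omega>)
    let ?l = "limsup (\<lambda>n. ereal ((\<Sum>i<n. \<omega> i - 1) / ?h n))"
    have up: "?l \<le> ereal (1 + 1 / real (Suc p))" for p
      using eventually_conj[OF h elim(1)[rule_format, of p]]
      by (intro Limsup_bounded) (auto elim!: eventually_mono simp: divide_le_eq)
    have "(\<lambda>p. ereal (1 + 1 / real (Suc p))) \<longlonglongrightarrow> ereal (1 + 0)"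
      by (intro tendsto_intros) real_asymp
    from LIMSEQ_le_const[OF this, of ?l] up have le: "?l \<le> 1" by (simp add: one_ereal_def)
    have low: "ereal (1 - 1 / real (Suc (Suc p))) \<le> ?l" for p
    proof (rule ccontr)
      assume "\<not> ereal (1 - 1 / real (Suc (Suc p))) \<le> ?l"
      hence "\<forall>\<^sub>F n in sequentially. ereal ((\<Sum>i<n. \<omega> i - 1) / ?h n) < ereal (1 - 1 / real (Suc (Suc p)))"
        by (intro Limsup_lessD) auto
      with h have "\<forall>\<^sub>F n in sequentially. \<not> (1 - 1 / real (Suc (Suc p))) * ?h n \<le> (\<Sum>i<n. \<omega> i - 1)"
        by eventually_elim (auto simp: divide_less_eq not_le)
      thus False using elim(2)[rule_format, of p] by (simp add: frequently_def)
    qed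
    have "(\<lambda>p. ereal (1 - 1 / real (Suc (Suc p)))) \<longlonglongrightarrow> ereal (1 - 0)"
      by (intro tendsto_intros) real_asymp
    from LIMSEQ_le_const2[OF this, of ?l] low have "1 \<le> ?l" by (simp add: one_ereal_def)
    with le show ?case by (rule antisym)
  qed
qed

section \<open>The transfer operators\<close>

text \<open>Here \<open>a\<close> stands for the digits of \<open>\<alpha>\<close>. The bound
  \<open>\<gamma> i \<le> 1\<close> keeps the exponent \<open>1 + \<gamma> i\<close> at most 2, the
  source of the constant in \<open>exp (- 2 / a i)\<close>.\<close>

locale digit_system =
  fixes a :: "nat \<Rightarrow> nat" and \<gamma> :: "nat \<Rightarrow> real"
  assumes a_ge_1: "1 \<le> a i" and \<gamma>_pos: "0 < \<gamma> i" and \<gamma>_le_1: "\<gamma> i \<le> 1"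
begin

definition weight :: "nat \<Rightarrow> nat \<Rightarrow> real" where
  "weight i w = real w powr - (1 + \<gamma> i)"

text \<open>For \<open>m \<ge> 1\<close> this is the Hurwitz zeta function at
  \<open>1 + \<gamma> i\<close> and m; \<open>tail i (a i)\<close> normalises the law of the i-th
  independent digit.\<close>

definition tail :: "nat \<Rightarrow> nat \<Rightarrow> real" where
  "tail i m = infsum (weight i) {m..}"

lemma weight_nonneg: "0 \<le> weight i w"
  by (simp add: weight_def)

lemma weight_pos: "1 \<le> w \<Longrightarrow> 0 < weight i w"
  by (simp add: weight_def)

lemma weight_summable_on: "weight i summable_on A"
proof -
  have "summable (weight i)"
    unfolding weight_def using \<gamma>_pos[of i] by (simp add: summable_real_powr_iff)
  hence "weight i summable_on UNIV" by (rule summable_nonneg_imp_summable_on) (rule weight_nonneg)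
  thus ?thesis by (rule summable_on_subset_banach) simp
qed

lemma tail_Suc: "tail i m = weight i m + tail i (Suc m)"
proof -
  have "{m..} = {m} \<union> {Suc m..}" by auto
  hence "tail i m = infsum (weight i) ({m} \<union> {Suc m..})" by (simp only: tail_def)
  also have "\<dots> = infsum (weight i) {m} + infsum (weight i) {Suc m..}"
    by (rule infsum_Un_disjoint) (auto intro: weight_summable_on)
  finally show ?thesis by (simp add: tail_def)
qed

lemma tail_nonneg: "0 \<le> tail i m"
  unfolding tail_def by (rule infsum_nonneg) (rule weight_nonneg)

lemma tail_pos: "1 \<le> m \<Longrightarrow> 0 < tail i m"
  using tail_Suc[of i m] weight_pos[of m i] tail_nonneg[of i "Suc m"] by linarith

lemma X_seq_ge_1: "x \<in> X_seq a n \<Longrightarrow> 1 \<le> x i"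
  using a_ge_1[of "n + i"] by (auto simp: X_seq_def intro: order_trans)

lemma case_nat_X_seq: "x \<in> X_seq a (Suc n) \<Longrightarrow> a n \<le> w \<Longrightarrow> case_nat w x \<in> X_seq a n"
  by (auto simp: X_seq_def split: nat.split)

text \<open>With t the value of the shifted fraction, \<open>ln (x 0 + t)\<close> exceeds
  \<open>ln (x 0)\<close> by at most \<open>t / x 0 \<le> 1 / a n\<close>, and the exponent
  multiplies this by at most 2.\<close>

lemma \<phi>_bounds:
  assumes x: "x \<in> X_seq a n"
  shows "weight n (x 0) * exp (- 2 / real (a n)) \<le> \<phi> \<gamma> n x" "\<phi> \<gamma> n x \<le> weight n (x 0)"
proof -
  define t where "t = cf (\<lambda>i. x (Suc i))"
  define s where "s = 1 + \<gamma> n"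
  have s: "0 < s" "s \<le> 2" using \<gamma>_pos[of n] \<gamma>_le_1[of n] by (auto simp: s_def)
  have t: "0 < t" "t < 1" using cf_bounds[of "\<lambda>i. x (Suc i)", OF X_seq_ge_1[OF x]] by (auto simp: t_def)
  have x0: "1 \<le> real (x 0)" using X_seq_ge_1[OF x, of 0] by simp
  have ax: "real (a n) \<le> real (x 0)" using x by (auto simp: X_seq_def dest: spec[of _ 0])
  have a1: "1 \<le> real (a n)" using a_ge_1[of n] by simp
  have phi: "\<phi> \<gamma> n x = (real (x 0) + t) powr - s"
  proof -
    have "2 * ((1 + \<gamma> n) / 2) = s" by (simp add: s_def)
    thus ?thesis unfolding \<phi>_def \<delta>_def cf_rec[of x, OF X_seq_ge_1[OF x]] t_def[symmetric]
      using x0 t by (simp add: powr_minus powr_divide inverse_eq_divide)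
  qed
  show "\<phi> \<gamma> n x \<le> weight n (x 0)"
    unfolding phi weight_def s_def[symmetric] using x0 t s by (intro powr_mono2') auto
  have "t / real (x 0) \<le> 1 / real (a n)" using t a1 ax by (intro frac_le) auto
  moreover have "ln (1 + t / real (x 0)) \<le> t / real (x 0)" using t x0 by (intro ln_add_one_self_le_self) auto
  ultimately have l: "ln (1 + t / real (x 0)) \<le> 1 / real (a n)" by linarith
  have "ln (real (x 0) + t) = ln (real (x 0)) + ln (1 + t / real (x 0))"
  proof -
    have "real (x 0) + t = real (x 0) * (1 + t / real (x 0))" using x0 by (simp add: distrib_left)
    moreover have "0 < 1 + t / real (x 0)" using t x0 by (intro add_pos_nonneg) auto
    ultimately show ?thesis using x0 by (simp add: ln_mult_pos)
  qed
  moreover have "s * ln (1 + t / real (x 0)) \<le> s * (1 / real (a n))"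
    using l s by (intro mult_left_mono) auto
  ultimately have "s * ln (real (x 0) + t) \<le> s * ln (real (x 0)) + s * (1 / real (a n))"
    by (simp only: distrib_left add_left_mono)
  also have "\<dots> \<le> s * ln (real (x 0)) + 2 * (1 / real (a n))"
    using s by (intro add_left_mono mult_right_mono) auto
  finally have "exp (- s * ln (real (x 0)) + - 2 / real (a n)) \<le> exp (- s * ln (real (x 0) + t))" by simp
  thus "weight n (x 0) * exp (- 2 / real (a n)) \<le> \<phi> \<gamma> n x"
    unfolding phi weight_def s_def[symmetric] exp_add using x0 t by (simp add: powr_def)
qed

lemma \<phi>_nonneg: "0 \<le> \<phi> \<gamma> n x"
  by (simp add: \<phi>_def)

text \<open>One application of the operator; u is later the indicator of a prescribed digit or the
  constant 1. Summability is recorded because \<open>infsum\<close> is 0 on families that are not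
  summable.\<close>

lemma L_op_mono_weight:
  assumes x: "x \<in> X_seq a (Suc n)"
    and f: "\<And>w. a n \<le> w \<Longrightarrow> 0 \<le> f (case_nat w x)"
      "\<And>w. a n \<le> w \<Longrightarrow> f (case_nat w x) \<le> b * u w"
    and u: "0 \<le> b" "\<And>w. 0 \<le> u w" "\<And>w. u w \<le> 1"
  shows "(\<lambda>w. \<phi> \<gamma> n (case_nat w x) * f (case_nat w x)) summable_on {l. a n \<le> l}"
    and "0 \<le> L_op a \<gamma> n f x"
    and "L_op a \<gamma> n f x \<le> b * infsum (\<lambda>w. weight n w * u w) {a n..}"
proof -
  have set: "{l. a n \<le> l} = {a n..}" by auto
  have wu: "(\<lambda>w. weight n w * u w) summable_on {a n..}"
    by (rule summable_on_comparison_test[OF weight_summable_on[of n]])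
      (use u weight_nonneg in \<open>auto intro!: mult_left_le\<close>)
  hence bwu: "(\<lambda>w. b * (weight n w * u w)) summable_on {a n..}" by (rule summable_on_cmult_right)
  have le: "\<phi> \<gamma> n (case_nat w x) * f (case_nat w x) \<le> b * (weight n w * u w)" if "a n \<le> w" for w
  proof -
    have "\<phi> \<gamma> n (case_nat w x) * f (case_nat w x) \<le> weight n w * (b * u w)"
      using \<phi>_bounds(2)[OF case_nat_X_seq[OF x that]] f[OF that] weight_nonneg \<phi>_nonneg
      by (intro mult_mono) auto
    thus ?thesis by (simp add: algebra_simps)
  qed
  have nonneg: "0 \<le> \<phi> \<gamma> n (case_nat w x) * f (case_nat w x)" if "a n \<le> w" for w
    using f(1)[OF that] \<phi>_nonneg by simp
  show sm: "(\<lambda>w. \<phi> \<gamma> n (case_nat w x) * f (case_nat w x)) summable_on {l. a n \<le> l}"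
    unfolding set by (rule summable_on_comparison_test[OF bwu]) (use le nonneg in auto)
  show "0 \<le> L_op a \<gamma> n f x" unfolding L_op_def by (rule infsum_nonneg) (use nonneg in auto)
  have "L_op a \<gamma> n f x \<le> infsum (\<lambda>w. b * (weight n w * u w)) {a n..}"
    unfolding L_op_def using sm bwu le unfolding set by (intro infsum_mono) auto
  also have "\<dots> = b * infsum (\<lambda>w. weight n w * u w) {a n..}"
    by (rule infsum_cmult_right) (rule wu)
  finally show "L_op a \<gamma> n f x \<le> b * infsum (\<lambda>w. weight n w * u w) {a n..}" .
qed

lemma infsum_weight_single:
  assumes "a n \<le> v"
  shows "infsum (\<lambda>w. weight n w * of_bool (w = v)) {a n..} = weight n v"
proof -
  have "infsum (\<lambda>w. weight n w * of_bool (w = v)) {a n..} = infsum (\<lambda>w. weight n w * of_bool (w = v)) {v}"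
    using assms by (intro infsum_cong_neutral) auto
  thus ?thesis by simp
qed

text \<open>Each operator sums out one digit: a prescribed digit contributes its weight, a free one
  the full tail. The remaining indicator carries the constraints on digits not yet summed, as
  \<open>x j\<close> is the digit with index \<open>K + j\<close>. The case \<open>k = 0\<close>
  covers the constant function 1.\<close>

lemma L_iter_upper:
  assumes f: "\<And>x. x \<in> X_seq a 0 \<Longrightarrow> 0 \<le> f x"
      "\<And>x. x \<in> X_seq a 0 \<Longrightarrow> f x \<le> of_bool (\<forall>j<k. x j = v j)"
    and v: "\<And>i. i < k \<Longrightarrow> a i \<le> v i" and x: "x \<in> X_seq a K"
  shows "0 \<le> L_iter a \<gamma> 0 K f x"
    and "L_iter a \<gamma> 0 K f x \<le>
      (\<Prod>i<K. if i < k then weight i (v i) else tail i (a i)) * of_bool (\<forall>j. K + j < k \<longrightarrow> x j = v (K + j))"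
proof -
  have "0 \<le> L_iter a \<gamma> 0 K f x \<and> L_iter a \<gamma> 0 K f x \<le>
      (\<Prod>i<K. if i < k then weight i (v i) else tail i (a i)) * of_bool (\<forall>j. K + j < k \<longrightarrow> x j = v (K + j))"
    using x
  proof (induction K arbitrary: x)
    case 0
    thus ?case using f by simp
  next
    case (Suc K)
    define b where "b = (\<Prod>i<K. if i < k then weight i (v i) else tail i (a i)) *
      of_bool (\<forall>j. Suc K + j < k \<longrightarrow> x j = v (Suc K + j))"
    define u :: "nat \<Rightarrow> real" where "u w = (if K < k then of_bool (w = v K) else 1)" for w
    have b: "0 \<le> b" unfolding b_def by (intro mult_nonneg_nonneg prod_nonneg) (auto simp: weight_nonneg tail_nonneg)
    have split: "(\<forall>j. K + j < k \<longrightarrow> case_nat w x j = v (K + j)) \<longleftrightarrow>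
        (K < k \<longrightarrow> w = v K) \<and> (\<forall>j. Suc K + j < k \<longrightarrow> x j = v (Suc K + j))" for w
    proof -
      have "(\<forall>j. Q j) \<longleftrightarrow> Q 0 \<and> (\<forall>j. Q (Suc j))" for Q :: "nat \<Rightarrow> bool" by (metis nat.exhaust)
      from this[of "\<lambda>j. K + j < k \<longrightarrow> case_nat w x j = v (K + j)"] show ?thesis by simp
    qed
    have IH: "0 \<le> L_iter a \<gamma> 0 K f (case_nat w x)" "L_iter a \<gamma> 0 K f (case_nat w x) \<le> b * u w"
      if "a K \<le> w" for w
    proof -
      have "(\<Prod>i<K. if i < k then weight i (v i) else tail i (a i)) *
          of_bool (\<forall>j. K + j < k \<longrightarrow> case_nat w x j = v (K + j)) = b * u w"
        unfolding split b_def u_def by (auto simp: of_bool_def)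
      thus "0 \<le> L_iter a \<gamma> 0 K f (case_nat w x)" "L_iter a \<gamma> 0 K f (case_nat w x) \<le> b * u w"
        using Suc.IH[OF case_nat_X_seq[OF Suc.prems that]] by simp_all
    qed
    have u: "0 \<le> u w" "u w \<le> 1" for w by (auto simp: u_def)
    note op = L_op_mono_weight[where f = "L_iter a \<gamma> 0 K f", OF Suc.prems IH b u]
    have "infsum (\<lambda>w. weight K w * u w) {a K..} = (if K < k then weight K (v K) else tail K (a K))"
      using infsum_weight_single[OF v, of K] by (simp add: u_def tail_def)
    thus ?case using op(2,3) by (simp add: b_def algebra_simps)
  qed
  thus "0 \<le> L_iter a \<gamma> 0 K f x"
    and "L_iter a \<gamma> 0 K f x \<le>
      (\<Prod>i<K. if i < k then weight i (v i) else tail i (a i)) * of_bool (\<forall>j. K + j < k \<longrightarrow> x j = v (K + j))"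
    by auto
qed

lemma L_iter_lower:
  assumes "x \<in> X_seq a K"
  shows "(\<Prod>i<K. tail i (a i) * exp (- 2 / real (a i))) \<le> L_iter a \<gamma> 0 K (\<lambda>_. 1) x"
  using assms
proof (induction K arbitrary: x)
  case (Suc K)
  let ?f = "L_iter a \<gamma> 0 K (\<lambda>_. 1)"
  define c where "c = (\<Prod>i<K. tail i (a i) * exp (- 2 / real (a i)))"
  define b where "b = (\<Prod>i<K. tail i (a i))"
  have b: "0 \<le> b" unfolding b_def by (intro prod_nonneg) (simp add: tail_nonneg)
  have c: "0 \<le> c" unfolding c_def by (intro prod_nonneg) (simp add: tail_nonneg)
  \<comment> \<open>The upper bound serves only to make the series summable.\<close>
  have up: "0 \<le> ?f (case_nat w x)" "?f (case_nat w x) \<le> b * 1" if "a K \<le> w" for w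
    using L_iter_upper[of "\<lambda>_. 1" 0 undefined "case_nat w x" K] case_nat_X_seq[OF Suc.prems that]
    by (auto simp: b_def)
  have set: "{l. a K \<le> l} = {a K..}" by auto
  have sm: "(\<lambda>w. \<phi> \<gamma> K (case_nat w x) * ?f (case_nat w x)) summable_on {a K..}"
    using L_op_mono_weight(1)[where f = ?f and u = "\<lambda>_. 1", OF Suc.prems up b] by (simp add: set)
  have "(\<Prod>i<Suc K. tail i (a i) * exp (- 2 / real (a i))) = (c * exp (- 2 / real (a K))) * tail K (a K)"
    by (simp add: c_def)
  also have "\<dots> = infsum (\<lambda>w. (c * exp (- 2 / real (a K))) * weight K w) {a K..}"
    unfolding tail_def by (rule infsum_cmult_right[symmetric]) (rule weight_summable_on)
  also have "\<dots> \<le> infsum (\<lambda>w. \<phi> \<gamma> K (case_nat w x) * ?f (case_nat w x)) {a K..}"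
  proof (rule infsum_mono[OF _ sm])
    show "(\<lambda>w. (c * exp (- 2 / real (a K))) * weight K w) summable_on {a K..}"
      by (rule summable_on_cmult_right) (rule weight_summable_on)
    fix w assume "w \<in> {a K..}"
    hence w: "case_nat w x \<in> X_seq a K" using case_nat_X_seq[OF Suc.prems] by simp
    have "(weight K w * exp (- 2 / real (a K))) * c \<le> \<phi> \<gamma> K (case_nat w x) * ?f (case_nat w x)"
      using \<phi>_bounds(1)[OF w] Suc.IH[OF w] c by (intro mult_mono) (auto simp: c_def \<phi>_nonneg)
    thus "(c * exp (- 2 / real (a K))) * weight K w \<le> \<phi> \<gamma> K (case_nat w x) * ?f (case_nat w x)"
      by (simp add: algebra_simps)
  qed
  finally show ?case by (simp add: L_op_def set)
qed simp

text \<open>In the ratio the tails of the free digits cancel. What is lost is the product of the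
  factors \<open>exp (2 / a i)\<close> from the denominator, bounded uniformly in K.\<close>

lemma P_iter_cylinder_le:
  assumes v: "\<And>i. i < k \<Longrightarrow> a i \<le> v i" and x: "x \<in> X_seq a K" and "k \<le> K"
    and sm: "summable (\<lambda>n. 1 / real (a n))"
  shows "P_iter a \<gamma> 0 K (indicator (cylinder a 0 k v)) x
    \<le> exp (2 * (\<Sum>n. 1 / real (a n))) * (\<Prod>i<k. weight i (v i) / tail i (a i))"
proof -
  let ?I = "indicator (cylinder a 0 k v) :: (nat \<Rightarrow> nat) \<Rightarrow> real"
  let ?D = "\<Prod>i<K. tail i (a i) * exp (- 2 / real (a i))"
  have t: "0 < tail i (a i)" for i by (rule tail_pos) (rule a_ge_1)
  have D: "0 < ?D" using t by (intro prod_pos) auto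
  have "L_iter a \<gamma> 0 K ?I x \<le> (\<Prod>i<K. if i < k then weight i (v i) else tail i (a i)) *
      of_bool (\<forall>j. K + j < k \<longrightarrow> x j = v (K + j))"
    by (rule L_iter_upper(2)[OF _ _ v x]) (auto simp: cylinder_def indicator_def)
  hence num: "L_iter a \<gamma> 0 K ?I x \<le> (\<Prod>i<K. if i < k then weight i (v i) else tail i (a i))"
    using \<open>k \<le> K\<close> by simp
  have num0: "0 \<le> (\<Prod>i<K. if i < k then weight i (v i) else tail i (a i))"
    by (intro prod_nonneg) (auto simp: weight_nonneg tail_nonneg)
  have "P_iter a \<gamma> 0 K ?I x = L_iter a \<gamma> 0 K ?I x / L_iter a \<gamma> 0 K (\<lambda>_. 1) x"
    by (simp add: P_iter_def)
  also have "\<dots> \<le> (\<Prod>i<K. if i < k then weight i (v i) else tail i (a i)) / ?D"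
    using num num0 L_iter_lower[OF x] D by (intro frac_le) auto
  also have "\<dots> = (\<Prod>i<K. (if i < k then weight i (v i) / tail i (a i) else 1) * exp (2 * (1 / real (a i))))"
    unfolding prod_dividef[symmetric]
  proof (intro prod.cong refl)
    fix i
    show "(if i < k then weight i (v i) else tail i (a i)) / (tail i (a i) * exp (- 2 / real (a i))) =
        (if i < k then weight i (v i) / tail i (a i) else 1) * exp (2 * (1 / real (a i)))"
      using t[of i] by (simp add: exp_minus divide_inverse)
  qed
  also have "\<dots> = (\<Prod>i<K. if i < k then weight i (v i) / tail i (a i) else 1) * exp (2 * (\<Sum>i<K. 1 / real (a i)))"
    by (simp add: prod.distrib exp_sum sum_distrib_left)
  also have "(\<Prod>i<K. if i < k then weight i (v i) / tail i (a i) else 1) = (\<Prod>i<k. weight i (v i) / tail i (a i))"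
    using \<open>k \<le> K\<close> by (intro prod.mono_neutral_cong_right) auto
  also have "(\<Prod>i<k. weight i (v i) / tail i (a i)) * exp (2 * (\<Sum>i<K. 1 / real (a i)))
      \<le> (\<Prod>i<k. weight i (v i) / tail i (a i)) * exp (2 * (\<Sum>n. 1 / real (a n)))"
    using sm by (intro mult_left_mono prod_nonneg)
      (auto simp: weight_nonneg tail_nonneg intro!: sum_le_suminf)
  finally show ?thesis by (simp add: mult.commute)
qed

text \<open>The indicator of a cylinder of length k is constant on cylinders at least that long, so
  its coefficient is at most \<open>1 / r ^ k\<close> and the defining limit of the measure applies
  to it.\<close>

lemma limit_measure_cylinder_le:
  assumes lim: "limit_measures a \<gamma> r \<nu>" and r: "0 < r" "r < 1"
    and v: "\<And>i. i < k \<Longrightarrow> a i \<le> v i" and sm: "summable (\<lambda>n. 1 / real (a n))"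
  shows "measure (\<nu> 0) (cylinder a 0 k v)
    \<le> exp (2 * (\<Sum>n. 1 / real (a n))) * (\<Prod>i<k. weight i (v i) / tail i (a i))"
proof -
  let ?I = "indicator (cylinder a 0 k v) :: (nat \<Rightarrow> nat) \<Rightarrow> real"
  have P: "prob_space (\<nu> 0)" and S: "sets (\<nu> 0) = sets (seq_space a 0)"
    and L: "\<And>f x. bounded (f ` X_seq a 0) \<Longrightarrow> holder_coeff a r 0 f < \<infinity> \<Longrightarrow> (\<And>k. x k \<in> X_seq a (0 + k)) \<Longrightarrow>
        (\<lambda>k. P_iter a \<gamma> 0 k f (x k)) \<longlonglongrightarrow> (\<integral>y. f y \<partial>\<nu> 0)"
    using lim unfolding limit_measures_def by blast+
  interpret prob_space "\<nu> 0" by (rule P)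
  have "holder_coeff a r 0 ?I \<le> ereal (1 / r ^ k)"
    unfolding holder_coeff_def
  proof (rule Sup_least, clarify)
    fix j w x y assume j: "1 \<le> j" and xy: "x \<in> cylinder a 0 j w" "y \<in> cylinder a 0 j w"
    show "ereal (\<bar>?I x - ?I y\<bar> / r ^ j) \<le> ereal (1 / r ^ k)"
    proof (cases "k \<le> j")
      case True
      have "x \<in> cylinder a 0 k v \<longleftrightarrow> y \<in> cylinder a 0 k v"
        using xy True unfolding cylinder_def by auto
      hence "?I x = ?I y" by (simp add: indicator_def)
      thus ?thesis using r by simp
    next
      case False
      have "\<bar>?I x - ?I y\<bar> / r ^ j \<le> 1 / r ^ k"
        using r False by (intro frac_le power_decreasing) (auto simp: indicator_def)
      thus ?thesis by simp
    qed
  qed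
  hence h: "holder_coeff a r 0 ?I < \<infinity>" by (rule order.strict_trans1) simp
  have b: "bounded (?I ` X_seq a 0)"
    by (rule boundedI[of _ 1]) (auto simp: indicator_def)
  \<comment> \<open>The limit needs some base points; the shifts of \<open>a\<close> itself are
    admissible.\<close>
  have x: "(\<lambda>i. a (K + i)) \<in> X_seq a (0 + K)" for K by (simp add: X_seq_def)
  have "(\<lambda>K. P_iter a \<gamma> 0 K ?I (\<lambda>i. a (K + i))) \<longlonglongrightarrow> (\<integral>y. ?I y \<partial>\<nu> 0)"
    by (rule L[OF b h x])
  moreover have "(\<integral>y. ?I y \<partial>\<nu> 0) = measure (\<nu> 0) (cylinder a 0 k v)"
    using S cylinder_sets[of a 0 k v] sets.sets_into_space by (simp add: Int_absorb2)
  ultimately have "(\<lambda>K. P_iter a \<gamma> 0 K ?I (\<lambda>i. a (K + i))) \<longlonglongrightarrow> measure (\<nu> 0) (cylinder a 0 k v)" by simp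
  thus ?thesis
    by (rule LIMSEQ_le_const2) (use x v sm in \<open>auto intro!: exI[of _ k] P_iter_cylinder_le\<close>)
qed

end

section \<open>Independent digits coupled to exponential variables\<close>

context digit_system
begin

text \<open>The mean value theorem for \<open>- (x powr - \<gamma> i / \<gamma> i)\<close>, whose
  derivative is the weight. This replaces the integral in the integral test.\<close>

lemma weight_telescope:
  assumes "1 \<le> w"
  shows "weight i (Suc w) \<le> real w powr - \<gamma> i / \<gamma> i - real (Suc w) powr - \<gamma> i / \<gamma> i"
    and "real w powr - \<gamma> i / \<gamma> i - real (Suc w) powr - \<gamma> i / \<gamma> i \<le> weight i w"
proof -
  have w: "0 < real w" using assms by simp
  have "((\<lambda>x. - (x powr - \<gamma> i / \<gamma> i)) has_real_derivative x powr - (1 + \<gamma> i)) (at x)"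
    if "real w \<le> x" for x
  proof -
    have e: "- (1 + \<gamma> i) = - \<gamma> i - 1" by simp
    show ?thesis unfolding e using that w \<gamma>_pos[of i] by (auto intro!: derivative_eq_intros)
  qed
  from MVT2[of "real w" "real (Suc w)", OF _ this]
  obtain z where z: "real w < z" "z < real (Suc w)"
    "- (real (Suc w) powr - \<gamma> i / \<gamma> i) - - (real w powr - \<gamma> i / \<gamma> i) = (real (Suc w) - real w) * z powr - (1 + \<gamma> i)"
    by auto
  have eq: "real w powr - \<gamma> i / \<gamma> i - real (Suc w) powr - \<gamma> i / \<gamma> i = z powr - (1 + \<gamma> i)"
    using z(3) by simp
  show "weight i (Suc w) \<le> real w powr - \<gamma> i / \<gamma> i - real (Suc w) powr - \<gamma> i / \<gamma> i"
    unfolding eq weight_def using z w \<gamma>_pos[of i] by (intro powr_mono2') auto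
  show "real w powr - \<gamma> i / \<gamma> i - real (Suc w) powr - \<gamma> i / \<gamma> i \<le> weight i w"
    unfolding eq weight_def using z w \<gamma>_pos[of i] by (intro powr_mono2') auto
qed

text \<open>Summing the telescoping bounds from m on gives
  \<open>m powr - \<gamma> i / \<gamma> i\<close> in the middle.\<close>

lemma tail_bounds:
  assumes "1 \<le> m"
  shows "real m powr - \<gamma> i / \<gamma> i \<le> tail i m" "tail i (Suc m) \<le> real m powr - \<gamma> i / \<gamma> i"
proof -
  define u where "u w = real w powr - \<gamma> i / \<gamma> i" for w
  define D where "D w = u w - u (Suc w)" for w
  have D: "weight i (Suc w) \<le> D w" "D w \<le> weight i w" if "m \<le> w" for w
    unfolding D_def u_def using that assms weight_telescope[of w i] by auto
  have "u \<longlonglongrightarrow> 0" unfolding u_def using \<gamma>_pos[of i] by real_asymp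
  hence "(\<lambda>n. u (n + m)) \<longlonglongrightarrow> 0" by (rule LIMSEQ_ignore_initial_segment)
  from telescope_sums'[OF this] have "(\<lambda>n. D (n + m)) sums u m" by (simp add: D_def)
  hence "((\<lambda>n. D (n + m)) has_sum u m) UNIV"
  proof (rule sums_nonneg_imp_has_sum)
    show "0 \<le> D (n + m)" for n using D(1)[of "n + m"] weight_nonneg[of i "Suc (n + m)"] by simp
  qed
  moreover have "range (\<lambda>n. n + m) = {m..}"
    by (auto simp: image_iff le_iff_add add.commute)
  ultimately have hs: "(D has_sum u m) {m..}"
    using has_sum_reindex[of "\<lambda>n. n + m" UNIV D "u m"] by (simp add: comp_def inj_on_def)
  have "u m \<le> tail i m" unfolding tail_def
    by (rule has_sum_mono[OF hs has_sum_infsum[OF weight_summable_on]]) (use D in auto)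
  thus "real m powr - \<gamma> i / \<gamma> i \<le> tail i m" by (simp add: u_def)
  have "Suc ` {m..} = {Suc m..}"
  proof (rule set_eqI)
    show "x \<in> Suc ` {m..} \<longleftrightarrow> x \<in> {Suc m..}" for x by (cases x) auto
  qed
  hence "((\<lambda>w. weight i (Suc w)) has_sum tail i (Suc m)) {m..}"
    using has_sum_reindex[of Suc "{m..}" "weight i"] has_sum_infsum[OF weight_summable_on[of i "{Suc m..}"]]
    by (simp add: comp_def tail_def)
  from has_sum_mono[OF this hs] D have "tail i (Suc m) \<le> u m" by simp
  thus "tail i (Suc m) \<le> real m powr - \<gamma> i / \<gamma> i" by (simp add: u_def)
qed

text \<open>The tail is \<open>m powr - \<gamma> i / \<gamma> i\<close> up to a factor between 1 and
  \<open>1 + \<gamma> i / m\<close>, since the first term of the tail is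
  \<open>\<gamma> i / m\<close> times that main term.\<close>

lemma ln_tail_bounds:
  assumes "1 \<le> m"
  shows "0 \<le> ln (tail i m) + \<gamma> i * ln (real m) + ln (\<gamma> i)"
    and "ln (tail i m) + \<gamma> i * ln (real m) + ln (\<gamma> i) \<le> \<gamma> i / real m"
proof -
  have m: "0 < real m" using assms by simp
  define u where "u = real m powr - \<gamma> i / \<gamma> i"
  have u: "0 < u" using m \<gamma>_pos[of i] by (simp add: u_def)
  have lnu: "ln u = - (\<gamma> i * ln (real m) + ln (\<gamma> i))"
    using m \<gamma>_pos[of i] by (simp add: u_def ln_divide_pos ln_powr)
  have "ln u \<le> ln (tail i m)" using u tail_bounds(1)[OF assms, of i] by (intro ln_mono) (auto simp: u_def)
  thus "0 \<le> ln (tail i m) + \<gamma> i * ln (real m) + ln (\<gamma> i)" using lnu by linarith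
  have "weight i m = u * (\<gamma> i / real m)"
  proof -
    have "real m powr - (1 + \<gamma> i) = real m powr - \<gamma> i * real m powr - 1"
    proof -
      have "- (1 + \<gamma> i) = - \<gamma> i + - 1" by simp
      thus ?thesis by (simp only: powr_add)
    qed
    thus ?thesis using m \<gamma>_pos[of i] by (simp add: u_def weight_def powr_minus divide_inverse)
  qed
  hence "tail i m \<le> u * (1 + \<gamma> i / real m)"
    using tail_bounds(2)[OF assms, of i] tail_Suc[of i m] by (simp add: u_def distrib_left)
  hence "ln (tail i m) \<le> ln (u * (1 + \<gamma> i / real m))"
    using tail_pos[OF assms] by (intro ln_mono) auto
  also have "\<dots> = ln u + ln (1 + \<gamma> i / real m)"
    using u m \<gamma>_pos[of i] by (intro ln_mult_pos) (auto intro: add_pos_nonneg)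
  also have "ln (1 + \<gamma> i / real m) \<le> \<gamma> i / real m"
    using m \<gamma>_pos[of i] by (intro ln_add_one_self_le_self) auto
  finally show "ln (tail i m) + \<gamma> i * ln (real m) + ln (\<gamma> i) \<le> \<gamma> i / real m" using lnu by linarith
qed

text \<open>For \<open>m \<ge> a i\<close>, the probability that the i-th independent digit is at
  least m.\<close>

definition survival :: "nat \<Rightarrow> nat \<Rightarrow> real" where
  "survival i m = tail i m / tail i (a i)"

text \<open>The inverse of the distribution function: if \<open>e\<close> is exponentially distributed, then
  \<open>digit i e\<close> takes the value \<open>w \<ge> a i\<close> with probability proportional to \<open>weight i w\<close>.\<close>

definition digit :: "nat \<Rightarrow> real \<Rightarrow> nat" where
  "digit i e = (LEAST m. a i \<le> m \<and> survival i (Suc m) \<le> exp (- e))"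

lemma survival_pos: "1 \<le> m \<Longrightarrow> 0 < survival i m"
  using tail_pos a_ge_1 by (simp add: survival_def)

lemma survival_start: "survival i (a i) = 1"
  using tail_pos[OF a_ge_1, of i i] by (simp add: survival_def)

lemma survival_Suc: "survival i m - survival i (Suc m) = weight i m / tail i (a i)"
  using tail_Suc[of i m] by (simp add: survival_def diff_divide_distrib[symmetric])

lemma survival_antimono: "m \<le> n \<Longrightarrow> survival i n \<le> survival i m"
proof (induction n rule: dec_induct)
  case (step n)
  have "0 \<le> weight i n / tail i (a i)" by (simp add: weight_nonneg tail_nonneg)
  thus ?case using survival_Suc[of i n] step.IH by linarith
qed simp

text \<open>The survival function tends to 0, so the \<open>LEAST\<close> in \<open>digit\<close> is
  attained.\<close>

lemma digit_props:
  shows "a i \<le> digit i e" "survival i (Suc (digit i e)) \<le> exp (- e)"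
proof -
  have "(\<lambda>m. real m powr - \<gamma> i / \<gamma> i / tail i (a i)) \<longlonglongrightarrow> 0"
  proof -
    have "(\<lambda>m. real m powr - g / g / t) \<longlonglongrightarrow> 0" if "0 < g" "0 < t" for g t :: real
      using that by real_asymp
    thus ?thesis using \<gamma>_pos tail_pos[OF a_ge_1] by blast
  qed
  hence "\<forall>\<^sub>F m in sequentially. real m powr - \<gamma> i / \<gamma> i / tail i (a i) < exp (- e)"
    by (rule order_tendstoD) simp
  moreover have "\<forall>\<^sub>F m in sequentially. a i \<le> m \<and> 1 \<le> m" by (intro eventually_conj eventually_ge_at_top)
  ultimately have "\<forall>\<^sub>F m in sequentially. a i \<le> m \<and> survival i (Suc m) \<le> exp (- e)"
  proof eventually_elim
    case (elim m)
    have "survival i (Suc m) \<le> real m powr - \<gamma> i / \<gamma> i / tail i (a i)"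
      unfolding survival_def using elim tail_bounds(2)[of m i] tail_pos[OF a_ge_1, of i i]
      by (intro divide_right_mono) auto
    thus ?case using elim by linarith
  qed
  then obtain m where "a i \<le> m \<and> survival i (Suc m) \<le> exp (- e)"
    by (auto simp: eventually_sequentially)
  from LeastI[of "\<lambda>m. a i \<le> m \<and> survival i (Suc m) \<le> exp (- e)", OF this]
  show "a i \<le> digit i e" "survival i (Suc (digit i e)) \<le> exp (- e)" unfolding digit_def by auto
qed

lemma digit_le_iff:
  assumes "a i \<le> m"
  shows "digit i e \<le> m \<longleftrightarrow> survival i (Suc m) \<le> exp (- e)"
proof
  assume "digit i e \<le> m"
  hence "survival i (Suc m) \<le> survival i (Suc (digit i e))" by (intro survival_antimono) simp
  thus "survival i (Suc m) \<le> exp (- e)" using digit_props(2)[of i e] by linarith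
next
  assume "survival i (Suc m) \<le> exp (- e)"
  thus "digit i e \<le> m" unfolding digit_def using assms by (intro Least_le) simp
qed

text \<open>Minimality of the digit m. Together with \<open>digit_props\<close> it places e between
  \<open>- ln (survival i m)\<close> and \<open>- ln (survival i (Suc m))\<close>. For the smallest
  digit the survival probability is 1, hence the condition \<open>0 \<le> e\<close>.\<close>

lemma le_survival_digit:
  assumes "0 \<le> e"
  shows "exp (- e) \<le> survival i (digit i e)"
proof (cases "digit i e = a i")
  case True
  thus ?thesis using assms by (simp add: survival_start)
next
  case False
  with digit_props(1)[of i e] obtain m where m: "digit i e = Suc m" "a i \<le> m"
    by (cases "digit i e") auto
  thus ?thesis using digit_le_iff[OF m(2), of e] by simp
qed

text \<open>At \<open>n = m\<close> and \<open>n = m + 1\<close> the value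
  \<open>- ln (survival i n)\<close> is \<open>\<gamma> i * ln (n / a i)\<close> with an error of at
  most \<open>1 / a i\<close>. Passing from m to \<open>m + 1\<close> changes the main term by at
  most \<open>\<gamma> i / m\<close>, again at most \<open>1 / a i\<close>; hence the constant
  2.\<close>

lemma digit_close:
  assumes "0 \<le> e"
  shows "\<bar>\<gamma> i * ln (real (digit i e) / real (a i)) - e\<bar> \<le> 2 / real (a i)"
proof -
  define m where "m = digit i e"
  have am: "a i \<le> m" unfolding m_def by (rule digit_props)
  have a: "1 \<le> a i" "0 < real (a i)" using a_ge_1[of i] by auto
  have m: "1 \<le> m" "0 < real m" using a am by auto
  have g: "0 < \<gamma> i" "\<gamma> i \<le> 1" using \<gamma>_pos \<gamma>_le_1 by auto
  have ga: "\<gamma> i / real (a i) \<le> 1 / real (a i)" "\<gamma> i / real m \<le> 1 / real (a i)"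
      "\<gamma> i / real (Suc m) \<le> 1 / real (a i)"
    using g a am by (auto intro!: frac_le)
  have lns: "ln (survival i n) = ln (tail i n) - ln (tail i (a i))" if "1 \<le> n" for n
    using tail_pos[OF that] tail_pos[OF a(1)] by (simp add: survival_def ln_divide_pos)
  have q: "ln (real m / real (a i)) = ln (real m) - ln (real (a i))"
    using m a by (simp add: ln_divide_pos)
  have "ln (exp (- e)) \<le> ln (survival i m)"
    unfolding m_def using le_survival_digit[OF assms] by (intro ln_mono) auto
  hence "- e \<le> ln (tail i m) - ln (tail i (a i))" using lns[OF m(1)] by simp
  hence up: "\<gamma> i * ln (real m / real (a i)) - e \<le> 1 / real (a i)"
    using ln_tail_bounds[OF m(1), of i] ln_tail_bounds[OF a(1), of i] ga
    unfolding q right_diff_distrib by linarith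
  have "ln (survival i (Suc m)) \<le> ln (exp (- e))"
    unfolding m_def using digit_props(2)[of i e] survival_pos[of "Suc (digit i e)" i] by (intro ln_mono) auto
  hence "ln (tail i (Suc m)) - ln (tail i (a i)) \<le> - e" using lns[of "Suc m"] by simp
  hence low: "e \<le> \<gamma> i * ln (real (Suc m)) - \<gamma> i * ln (real (a i)) + \<gamma> i / real (a i)"
    using ln_tail_bounds[of "Suc m" i] ln_tail_bounds[OF a(1), of i] by linarith
  have "ln (real (Suc m)) - ln (real m) = ln (1 + 1 / real m)"
  proof -
    have "1 + 1 / real m = real (Suc m) / real m" using m by (simp add: field_simps)
    thus ?thesis using m by (simp add: ln_divide_pos)
  qed
  also have "\<dots> \<le> 1 / real m" using m by (intro ln_add_one_self_le_self) auto
  finally have "\<gamma> i * (ln (real (Suc m)) - ln (real m)) \<le> \<gamma> i * (1 / real m)"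
    using g by (intro mult_left_mono) auto
  hence "\<gamma> i * ln (real (Suc m)) - \<gamma> i * ln (real m) \<le> \<gamma> i / real m" by (simp add: right_diff_distrib)
  hence "e - \<gamma> i * ln (real m / real (a i)) \<le> \<gamma> i / real m + \<gamma> i / real (a i)"
    using low unfolding q right_diff_distrib by linarith
  moreover have "2 / real (a i) = 1 / real (a i) + 1 / real (a i)" by simp
  moreover have "0 \<le> 1 / real (a i)" by simp
  ultimately show ?thesis using up ga unfolding m_def[symmetric] abs_le_iff by linarith
qed

lemma digit_measurable [measurable]: "digit i \<in> measurable borel (count_space UNIV)"
proof -
  have "(\<lambda>e. LEAST m. a i \<le> m \<and> survival i (Suc m) \<le> exp (- e)) \<in> measurable borel (count_space UNIV)"
    by measurable
  thus ?thesis by (simp add: digit_def[abs_def])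
qed

text \<open>The event is the half-line up to \<open>- ln (survival i (Suc m))\<close>, where the
  exponential distribution function is explicit.\<close>

lemma measure_digit_le:
  assumes "a i \<le> m"
  shows "measure std_exp {e. digit i e \<le> m} = 1 - survival i (Suc m)"
proof -
  have s: "0 < survival i (Suc m)" "survival i (Suc m) \<le> 1"
    using survival_pos[of "Suc m"] survival_antimono[of "a i" "Suc m" i] assms by (auto simp: survival_start)
  have "{e. digit i e \<le> m} = {..- ln (survival i (Suc m))}"
  proof (rule set_eqI)
    fix e
    have "survival i (Suc m) \<le> exp (- e) \<longleftrightarrow> ln (survival i (Suc m)) \<le> ln (exp (- e))"
      using s(1) by (simp only: ln_le_cancel_iff exp_gt_zero)
    thus "e \<in> {e. digit i e \<le> m} \<longleftrightarrow> e \<in> {..- ln (survival i (Suc m))}"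
      by (auto simp: digit_le_iff[OF assms])
  qed
  moreover have "emeasure std_exp {..- ln (survival i (Suc m))} = erlang_CDF 0 1 (- ln (survival i (Suc m)))"
    by (rule emeasure_erlang_density) simp
  moreover have "erlang_CDF 0 1 (- ln (survival i (Suc m))) = 1 - survival i (Suc m)"
    using s by (simp add: erlang_CDF_0)
  ultimately show ?thesis using s by (simp add: measure_def)
qed

lemma measure_digit_eq:
  assumes "a i \<le> m"
  shows "measure std_exp {e. digit i e = m} = weight i m / tail i (a i)"
proof (cases "m = a i")
  case True
  have "{e. digit i e = m} = {e. digit i e \<le> m}" using True digit_props(1)[of i] by (auto intro: antisym)
  thus ?thesis using measure_digit_le[OF assms] survival_Suc[of i m] True by (simp add: survival_start)
next
  case False
  with assms obtain k where k: "m = Suc k" "a i \<le> k" by (cases m) auto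
  have meas: "{e. digit i e \<le> n} \<in> sets std_exp" for n by measurable
  have "{e. digit i e = m} = {e. digit i e \<le> m} - {e. digit i e \<le> k}" using k by auto
  moreover have "measure std_exp ({e. digit i e \<le> m} - {e. digit i e \<le> k})
      = measure std_exp {e. digit i e \<le> m} - measure std_exp {e. digit i e \<le> k}"
    using k by (intro std_exp.finite_measure_Diff meas) auto
  ultimately have "measure std_exp {e. digit i e = m} = measure std_exp {e. digit i e \<le> m} - measure std_exp {e. digit i e \<le> k}"
    by (simp only:)
  thus ?thesis using measure_digit_le[OF assms] measure_digit_le[OF k(2)] survival_Suc[of i m] k by simp
qed

text \<open>Defined as an image of the exponential variables, not as a product of digit laws, so
  that almost sure statements about those variables carry over directly.\<close>

definition digit_measure :: "(nat \<Rightarrow> nat) measure" where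
  "digit_measure = distr std_exp_seq (seq_space a 0) (\<lambda>\<omega> i. digit i (\<omega> i))"

lemma digits_measurable:
  "(\<lambda>\<omega> i. digit i (\<omega> i)) \<in> measurable std_exp_seq (seq_space a 0)"
  unfolding seq_space_def
proof (rule measurable_measure_of)
  show "{cylinder a 0 k w |k w. True} \<subseteq> Pow (X_seq a 0)" using cylinder_subset by fastforce
  show "(\<lambda>\<omega> i. digit i (\<omega> i)) \<in> space std_exp_seq \<rightarrow> X_seq a 0"
    by (auto simp: X_seq_def digit_props)
next
  fix A assume "A \<in> {cylinder a 0 k w |k w. True}"
  then obtain k w where A: "A = cylinder a 0 k w" by auto
  have "(\<lambda>\<omega> i. digit i (\<omega> i)) -` A \<inter> space std_exp_seq = {\<omega> \<in> space std_exp_seq. \<forall>i<k. digit i (\<omega> i) = w i}"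
    by (auto simp: A cylinder_def X_seq_def digit_props)
  also have "\<dots> \<in> sets std_exp_seq" by measurable
  finally show "(\<lambda>\<omega> i. digit i (\<omega> i)) -` A \<inter> space std_exp_seq \<in> sets std_exp_seq" .
qed

lemma digit_measure_cylinder:
  assumes "\<And>i. i < k \<Longrightarrow> a i \<le> v i"
  shows "measure digit_measure (cylinder a 0 k v) = (\<Prod>i<k. weight i (v i) / tail i (a i))"
proof -
  have "(\<lambda>\<omega> i. digit i (\<omega> i)) -` cylinder a 0 k v \<inter> space std_exp_seq
      = {\<omega> \<in> space std_exp_seq. \<forall>i\<in>{..<k}. \<omega> i \<in> {e. digit i e = v i}}"
    by (auto simp: cylinder_def X_seq_def digit_props)
  hence "measure digit_measure (cylinder a 0 k v)
      = measure std_exp_seq {\<omega> \<in> space std_exp_seq. \<forall>i\<in>{..<k}. \<omega> i \<in> {e. digit i e = v i}}"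
    unfolding digit_measure_def by (simp add: measure_distr[OF digits_measurable cylinder_sets])
  also have "\<dots> = (\<Prod>i<k. measure std_exp {e. digit i e = v i})"
  proof -
    have "emeasure std_exp_seq {\<omega> \<in> space std_exp_seq. \<forall>i\<in>{..<k}. \<omega> i \<in> {e. digit i e = v i}}
        = (\<Prod>i<k. emeasure std_exp {e. digit i e = v i})"
      by (rule std_exp_seq.emeasure_PiM_Collect) (auto, measurable)
    thus ?thesis
      by (simp add: std_exp_seq.emeasure_eq_measure std_exp.emeasure_eq_measure prod_ennreal prod_nonneg)
  qed
  also have "\<dots> = (\<Prod>i<k. weight i (v i) / tail i (a i))"
    using assms by (intro prod.cong refl measure_digit_eq) simp
  finally show ?thesis .
qed

end

section \<open>Measurability, bounded perturbations and transfer of the law\<close>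

lemma coordinate_measurable:
  "(\<lambda>x. x i) \<in> measurable (seq_space a n) (count_space UNIV)"
  unfolding measurable_count_space_eq2_countable
proof (intro conjI ballI)
  fix m :: nat
  have "(\<lambda>x. x i) -` {m} \<inter> space (seq_space a n) = {x \<in> X_seq a n. map x [0..<Suc i] \<in> {u. u ! i = m}}"
    by (auto simp: space_seq_space nth_append simp del: upt_Suc)
  also have "\<dots> \<in> prefix_sets a n" unfolding prefix_sets_def by blast
  finally show "(\<lambda>x. x i) -` {m} \<inter> space (seq_space a n) \<in> sets (seq_space a n)"
    unfolding sigma_prefix_sets[symmetric] by (rule sigma_sets.Basic)
qed simp

lemma fin_cf_measurable:
  "(\<lambda>x. fin_cf k (\<lambda>i. x (j + i)) :: real) \<in> borel_measurable (seq_space a n)"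
proof (induction k arbitrary: j)
  case (Suc k)
  note coordinate_measurable [measurable]
  have [measurable]: "(\<lambda>x. fin_cf k (\<lambda>i. x (Suc (j + i))) :: real) \<in> borel_measurable (seq_space a n)"
    using Suc[of "Suc j"] by simp
  show ?case by simp
qed simp

lemma cf_measurable:
  assumes "\<And>i. 1 \<le> a i"
  shows "cf \<in> borel_measurable (seq_space a n)"
proof (rule borel_measurable_LIMSEQ_real)
  show "(\<lambda>x. fin_cf k x :: real) \<in> borel_measurable (seq_space a n)" for k
    using fin_cf_measurable[of k 0] by simp
  show "(\<lambda>k. fin_cf k x) \<longlonglongrightarrow> cf x" if "x \<in> space (seq_space a n)" for x
  proof (rule fin_cf_tendsto_cf)
    fix i
    have "1 \<le> a (n + i)" by (rule assms)
    also have "\<dots> \<le> x i" using that by (simp add: space_seq_space X_seq_def)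
    finally show "1 \<le> x i" .
  qed
qed

text \<open>Used twice: for the coupling error of the digits and for the passage from digits to
  denominators.\<close>

lemma limsup_lil_bounded_perturbation:
  fixes f g :: "nat \<Rightarrow> real"
  assumes f: "limsup (\<lambda>n. ereal (f n / sqrt (2 * real n * ln (ln (real n))))) = 1"
    and C: "\<And>n. \<bar>g n - f n\<bar> \<le> C"
  shows "limsup (\<lambda>n. ereal (g n / sqrt (2 * real n * ln (ln (real n))))) = 1"
proof -
  let ?h = "\<lambda>n. sqrt (2 * real n * ln (ln (real n)))"
  have "(\<lambda>n. (g n - f n) / ?h n) \<longlonglongrightarrow> 0"
  proof (rule Lim_null_comparison)
    have "\<forall>\<^sub>F n in sequentially. 0 < ?h n" by real_asymp
    thus "\<forall>\<^sub>F n in sequentially. norm ((g n - f n) / ?h n) \<le> C / ?h n"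
      by eventually_elim (use C in \<open>auto simp: abs_divide intro!: divide_right_mono\<close>)
    show "(\<lambda>n. C / ?h n) \<longlonglongrightarrow> 0" by real_asymp
  qed
  hence "(\<lambda>n. ereal ((g n - f n) / ?h n)) \<longlonglongrightarrow> ereal 0" by (simp only: lim_ereal)
  from ereal_limsup_lim_add[OF this, of "\<lambda>n. ereal (f n / ?h n)"] f
  have "limsup (\<lambda>n. ereal ((g n - f n) / ?h n) + ereal (f n / ?h n)) = 1" by simp
  thus ?thesis by (simp add: diff_divide_distrib)
qed

context digit_system
begin

lemma lil_digit_measure:
  assumes sm: "summable (\<lambda>n. 1 / real (a n))"
  shows "AE x in digit_measure.
    limsup (\<lambda>n. ereal ((\<Sum>k<n. \<gamma> k * ln (real (x k) / real (a k)) - 1) / sqrt (2 * real n * ln (ln (real n))))) = 1"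
proof -
  \<comment> \<open>The coupling estimate is available for nonnegative values only.\<close>
  have "AE e in std_exp. 0 \<le> e"
    by (subst AE_density) (auto simp: exponential_density_def)
  hence "AE \<omega> in std_exp_seq. 0 \<le> \<omega> i" for i
    by (intro AE_PiM_component) (auto intro: std_exp.prob_space_axioms)
  hence "AE \<omega> in std_exp_seq. \<forall>i. 0 \<le> \<omega> i" by (simp add: AE_all_countable)
  hence "AE \<omega> in std_exp_seq. limsup (\<lambda>n. ereal ((\<Sum>k<n. \<gamma> k * ln (real (digit k (\<omega> k)) / real (a k)) - 1)
      / sqrt (2 * real n * ln (ln (real n))))) = 1"
    using lil_std_exp
  proof eventually_elim
    case (elim \<omega>)
    show ?case
    proof (rule limsup_lil_bounded_perturbation[OF elim(2)])
      fix n
      have "\<bar>(\<Sum>k<n. \<gamma> k * ln (real (digit k (\<omega> k)) / real (a k)) - 1) - (\<Sum>k<n. \<omega> k - 1)\<bar>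
          = \<bar>\<Sum>k<n. \<gamma> k * ln (real (digit k (\<omega> k)) / real (a k)) - \<omega> k\<bar>"
        by (simp add: sum_subtractf)
      also have "\<dots> \<le> (\<Sum>k<n. \<bar>\<gamma> k * ln (real (digit k (\<omega> k)) / real (a k)) - \<omega> k\<bar>)" by (rule sum_abs)
      also have "\<dots> \<le> (\<Sum>k<n. 2 * (1 / real (a k)))"
        using digit_close elim(1) by (intro sum_mono) simp
      also have "\<dots> = 2 * (\<Sum>k<n. 1 / real (a k))" by (simp add: sum_distrib_left)
      also have "\<dots> \<le> 2 * (\<Sum>k. 1 / real (a k))"
        using sm by (intro mult_left_mono sum_le_suminf) auto
      finally show "\<bar>(\<Sum>k<n. \<gamma> k * ln (real (digit k (\<omega> k)) / real (a k)) - 1) - (\<Sum>k<n. \<omega> k - 1)\<bar>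
        \<le> 2 * (\<Sum>k. 1 / real (a k))" .
    qed
  qed
  \<comment> \<open>Measurability of the event is what allows the almost sure statement to pass
    through the image measure.\<close>
  moreover have "{x \<in> space (seq_space a 0). limsup (\<lambda>n. ereal ((\<Sum>k<n. \<gamma> k * ln (real (x k) / real (a k)) - 1)
      / sqrt (2 * real n * ln (ln (real n))))) = 1} \<in> sets (seq_space a 0)"
  proof -
    note coordinate_measurable [measurable]
    show ?thesis by measurable
  qed
  ultimately show ?thesis
    unfolding digit_measure_def by (simp add: AE_distr_iff[OF digits_measurable])
qed

lemma lil_limit_measure:
  assumes sm: "summable (\<lambda>n. 1 / real (a n))"
    and lim: "limit_measures a \<gamma> r \<nu>" and r: "0 < r" "r < 1"
  shows "AE x in \<nu> 0.
    limsup (\<lambda>n. ereal ((\<Sum>k<n. \<gamma> k * ln (real (x k) / real (a k)) - 1) / sqrt (2 * real n * ln (ln (real n))))) = 1"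
proof (rule AE_from_cylinder_bound[OF _ _ _ _ _ _ lil_digit_measure[OF sm]])
  have \<nu>: "prob_space (\<nu> 0)" "sets (\<nu> 0) = sets (seq_space a 0)"
    using lim unfolding limit_measures_def by auto
  show "finite_measure (\<nu> 0)" using \<nu>(1) by (rule prob_space.finite_measure)
  show "sets (\<nu> 0) = sets (seq_space a 0)" by (rule \<nu>)
  show "finite_measure digit_measure" unfolding digit_measure_def
    by (intro prob_space.finite_measure std_exp_seq.prob_space_distr digits_measurable)
  show "sets digit_measure = sets (seq_space a 0)" by (simp add: digit_measure_def)
  show "0 \<le> exp (2 * (\<Sum>n. 1 / real (a n)))" by simp
  fix k v
  show "measure (\<nu> 0) (cylinder a 0 k v)
      \<le> exp (2 * (\<Sum>n. 1 / real (a n))) * measure digit_measure (cylinder a 0 k v)"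
  proof (cases "\<forall>i<k. a i \<le> v i")
    case True
    thus ?thesis using limit_measure_cylinder_le[OF lim r _ sm, of k v] by (simp add: digit_measure_cylinder)
  next
    case False
    hence "cylinder a 0 k v = {}" by (auto simp: cylinder_def X_seq_def) metis
    thus ?thesis by simp
  qed
qed

end

text \<open>On \<open>X_set \<alpha>\<close> the digits agree with the floor formula for the
  iterates of \<open>cf_map\<close>, which is Borel measurable.\<close>

lemma partial_quotients_measurable:
  "(\<lambda>x. partial_quotients x k) \<in> measurable (restrict_space borel (X_set \<alpha>)) (count_space UNIV)"
proof -
  have [measurable]: "cf_map \<in> borel_measurable borel"
    unfolding cf_map_def frac_def by measurable
  have [measurable]: "(cf_map ^^ k) \<in> borel_measurable borel"
    by (induction k) (auto simp: comp_def)
  have "(\<lambda>x. nat \<lfloor>1 / (cf_map ^^ k) x\<rfloor>) \<in> measurable borel (count_space UNIV)" by measurable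
  hence "(\<lambda>x. nat \<lfloor>1 / (cf_map ^^ k) x\<rfloor>) \<in> measurable (restrict_space borel (X_set \<alpha>)) (count_space UNIV)"
    by (rule measurable_restrict_space1)
  moreover have "nat \<lfloor>1 / (cf_map ^^ k) x\<rfloor> = partial_quotients x k"
    if "x \<in> space (restrict_space borel (X_set \<alpha>))" for x
    using that cf_expansion(3)[of x k] by (auto simp: space_restrict_space X_set_def)
  ultimately show ?thesis by (subst measurable_cong[symmetric]) auto
qed

theorem theorem4p6:
  fixes \<alpha> r :: real
    and \<gamma> :: "nat \<Rightarrow> real"
    and \<nu> :: "nat \<Rightarrow> (nat \<Rightarrow> nat) measure"
  assumes "\<alpha> \<in> {0..1} - \<rat>"
    and "summable (\<lambda>n. 1 / real (partial_quotients \<alpha> n))"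
    and "\<And>n. \<gamma> n > 0"
    and "\<And>n. \<gamma> n * real (partial_quotients \<alpha> n) powr \<gamma> n = 1"
    and "0 < r" and "r < 1"
    and "uniformly_holder (partial_quotients \<alpha>) \<gamma> r"
    and "limit_measures (partial_quotients \<alpha>) \<gamma> r \<nu>"
  shows "(AE x in on_X_set \<alpha> (\<nu> 0).
            limsup (\<lambda>n. ereal
              ((\<Sum>k<n. (\<gamma> k * ln (real (partial_quotients x k) / real (partial_quotients \<alpha> k)) - 1))
                / sqrt (2 * real n * ln (ln (real n))))) = 1)
       \<and> (AE x in on_X_set \<alpha> (\<nu> 0).
            limsup (\<lambda>n. ereal
              ((\<Sum>k<n. ((\<gamma> k - (if k = 0 then 0 else \<gamma> (k - 1)))
                        * ln (real_of_int (approximant_denom (n - k) ((cf_map ^^ k) x))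
                              / real_of_int (approximant_denom (n - k) ((cf_map ^^ k) \<alpha>))) - 1))
                / sqrt (2 * real n * ln (ln (real n))))) = 1)"
  proof -
  let ?a = "partial_quotients \<alpha>"
  let ?h = "\<lambda>n. sqrt (2 * real n * ln (ln (real n)))"
  let ?S1 = "\<lambda>x n. \<Sum>k<n. \<gamma> k * ln (real (partial_quotients x k) / real (?a k)) - 1"
  let ?S2 = "\<lambda>x n. \<Sum>k<n. (\<gamma> k - (if k = 0 then 0 else \<gamma> (k - 1)))
      * ln (real_of_int (approximant_denom (n - k) ((cf_map ^^ k) x))
            / real_of_int (approximant_denom (n - k) ((cf_map ^^ k) \<alpha>))) - 1"
  have a1: "1 \<le> ?a i" for i using cf_expansion(1)[OF assms(1)] .
  have g1: "\<gamma> i \<le> 1" for i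
  proof -
    \<comment> \<open>A base of at least 1 has positive powers of at least 1, so the equation for
      \<open>\<gamma> i\<close> forces \<open>\<gamma> i \<le> 1\<close>.\<close>
    have "1 \<le> real (?a i) powr \<gamma> i" using a1[of i] assms(3)[of i] by (intro ge_one_powr_ge_zero) auto
    hence "\<gamma> i * 1 \<le> \<gamma> i * real (?a i) powr \<gamma> i" using assms(3)[of i] by (intro mult_left_mono) auto
    thus ?thesis using assms(4)[of i] by simp
  qed
  interpret digit_system ?a \<gamma>
    by unfold_locales (use a1 assms(3) g1 in auto)
  have sets\<nu>: "sets (\<nu> 0) = sets (seq_space ?a 0)" using assms(8) unfolding limit_measures_def by auto
  have space\<nu>: "space (\<nu> 0) = X_seq ?a 0"
    using sets_eq_imp_space_eq[OF sets\<nu>] by (simp add: space_seq_space)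
  have cf: "cf \<in> measurable (\<nu> 0) (restrict_space borel (X_set \<alpha>))"
  proof (rule measurable_restrict_space2)
    show "cf \<in> borel_measurable (\<nu> 0)"
      using cf_measurable[of ?a 0, OF a1] by (simp add: measurable_cong_sets[OF sets\<nu> refl])
    show "cf \<in> space (\<nu> 0) \<rightarrow> X_set \<alpha>"
    proof
      fix x assume "x \<in> space (\<nu> 0)"
      hence x: "x \<in> X_seq ?a 0" by (simp add: space\<nu>)
      have x1: "1 \<le> x i" for i using x by (rule X_seq_ge_1)
      show "cf x \<in> X_set \<alpha>"
        using x cf_bounds[of x, OF x1] cf_irrational[of x, OF x1] partial_quotients_cf[of x, OF x1]
        by (auto simp: X_set_def X_seq_def)
    qed
  qed
  have meas: "{x \<in> space (restrict_space borel (X_set \<alpha>)). limsup (\<lambda>n. ereal (?S1 x n / ?h n)) = 1}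
      \<in> sets (restrict_space borel (X_set \<alpha>))"
  proof -
    note partial_quotients_measurable [measurable]
    show ?thesis by measurable
  qed
  have "AE x in \<nu> 0. limsup (\<lambda>n. ereal (?S1 (cf x) n / ?h n)) = 1"
    using lil_limit_measure[OF assms(2,8,5,6)] AE_space
  proof eventually_elim
    case (elim x)
    hence "x \<in> X_seq ?a 0" by (simp add: space\<nu>)
    \<comment> \<open>On the sequence space \<open>partial_quotients\<close> inverts
      \<open>cf\<close>, which turns the statement on sequences into one on points.\<close>
    hence "partial_quotients (cf x) = x" by (intro partial_quotients_cf X_seq_ge_1)
    thus ?case using elim by simp
  qed
  hence 1: "AE x in on_X_set \<alpha> (\<nu> 0). limsup (\<lambda>n. ereal (?S1 x n / ?h n)) = 1"
    unfolding on_X_set_def by (subst AE_distr_iff[OF cf meas])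
  \<comment> \<open>The two sums are compared at every point of \<open>X_set \<alpha>\<close>, so
    the second claim holds wherever the first does.\<close>
  have "AE x in on_X_set \<alpha> (\<nu> 0). limsup (\<lambda>n. ereal (?S2 x n / ?h n)) = 1"
    using 1 AE_space
  proof eventually_elim
    case (elim x)
    hence x: "x \<in> {0..1} - \<rat>" "\<And>k. ?a k \<le> partial_quotients x k"
      by (auto simp: on_X_set_def space_restrict_space X_set_def)
    have den: "approximant_denom m ((cf_map ^^ k) y) = cf_denom m (\<lambda>i. partial_quotients y (k + i))"
      if "y \<in> {0..1} - \<rat>" for y m k
      using partial_quotients_cf_map[of "partial_quotients y" k, OF cf_expansion(1)[OF that]]
      unfolding cf_expansion(2)[OF that] by (simp add: approximant_denom_def cf_denom_def)
    show ?case
    proof (rule limsup_lil_bounded_perturbation[OF elim(1)])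
      fix n
      have "\<bar>?S2 x n - ?S1 x n\<bar> \<le> (\<Sum>k<n. 1 / real (?a k))"
        unfolding den[OF x(1)] den[OF assms(1)]
        by (rule denominator_sum_close[OF a1 x(2) less_imp_le[OF assms(3)] g1])
      also have "\<dots> \<le> (\<Sum>k. 1 / real (?a k))"
        using assms(2) by (intro sum_le_suminf) auto
      finally show "\<bar>?S2 x n - ?S1 x n\<bar> \<le> (\<Sum>k. 1 / real (?a k))" .
    qed
  qed
  with 1 show ?thesis by (intro conjI)
qed

end
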